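(* Let $\Omega\subset\mathbb{R}^n$ be open and bounded. Suppose that $p\in\mathcal{P}_1^{\log}(\Omega)$, $\alpha\in\mathcal{P}_0^{\log}(\Omega)$ and $(\alpha p)^+:=\operatorname{ess\,sup}_{\Omega}\alpha p<n$. If $f\in L^{p(\cdot)}(\Omega)$, then $$(\mathcal{I}_{\alpha(\cdot)}f)^{q(\cdot)}\in w\text{-}L^{p^\#_\alpha(\cdot)/q(\cdot)}(\Omega)$$ for every $q\in\mathcal{P}_0^{\log}(\Omega)$.
   Context: For measurable $g$ write $g^-:=\operatorname{ess\,inf}g$, $g^+:=\operatorname{ess\,sup}g$. $\mathcal{P}_0^{\log}(\Omega)$ is the set of $\log$-Hölder continuous exponents $g:\Omega\to(0,\infty)$ with $0<g^-\le g^+<\infty$; $\mathcal{P}_1^{\log}(\Omega)$ is the subset with $g^-\ge1$. Here $g$ is $\log$-Hölder continuous if there are $c,c'>0$, $g_\infty\ge1$ with $|g(x)-g(y)|\le\frac{c}{\log(e+1/|x-y|)}$ for $x,y\in\Omega$ and $|g(x)-g_\infty|\le\frac{c'}{\log(e+|x|)}$ for $x\in\Omega$ (the second condition is automatic on bounded sets for bounded $g$). $L^{s(\cdot)}(\Omega)$: measurable $f$ with $\int_\Omega|f(x)|^{s(x)}dx<\infty$, with Luxemburg (quasi-)norm $\|f\|_{L^{s(\cdot)}(\Omega)}:=\inf\{\lambda>0:\int_\Omega|f/\lambda|^{s(x)}dx\le1\}$. Weak space $w\text{-}L^{s(\cdot)}(\Omega)$: measurable $f$ with $\sup_{\lambda>0}\lambda\|\chi_{\{|f|>\lambda\}}\|_{L^{s(\cdot)}(\Omega)}<\infty$.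 Riesz potential: $\mathcal{I}_{\alpha(\cdot)}f(x):=\int_\Omega\frac{|f(y)|}{|x-y|^{n-\alpha(y)}}\,dy$. Sobolev conjugate: $p^\#_\alpha(x):=\frac{np(x)}{n-\alpha(x)p(x)}$. $(\mathcal{I}_{\alpha(\cdot)}f)^{q(\cdot)}$ denotes $x\mapsto(\mathcal{I}_{\alpha(\cdot)}f(x))^{q(x)}$. *)

theory Defs
  imports "HOL-Analysis.Analysis" "HOL-Probability.Essential_Supremum"
begin

text \<open>
  Measurability and integrals over \<open>\<Omega>\<close> are with respect to Lebesgue measure \<open>lebesgue_on \<Omega>\<close>.
  Functions on \<open>\<Omega>\<close> are total functions on \<open>real ^ 'n\<close> whose values off \<open>\<Omega>\<close> never matter.
\<close>

definition ess_sup_on :: "(real ^ 'n) set \<Rightarrow> (real ^ 'n \<Rightarrow> real) \<Rightarrow> ereal" where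
  "ess_sup_on \<Omega> g = esssup (lebesgue_on \<Omega>) (\<lambda>x. ereal (g x))"

definition ess_inf_on :: "(real ^ 'n) set \<Rightarrow> (real ^ 'n \<Rightarrow> real) \<Rightarrow> ereal" where
  "ess_inf_on \<Omega> g = Sup {z. AE x in lebesgue_on \<Omega>. z \<le> ereal (g x)}"

text \<open>For \<open>x = y\<close> the first inequality is trivial, whatever the value of \<open>1 / 0\<close>.\<close>

definition log_Holder_on :: "(real ^ 'n) set \<Rightarrow> (real ^ 'n \<Rightarrow> real) \<Rightarrow> bool" where
  "log_Holder_on \<Omega> g \<longleftrightarrow>
    (\<exists>c c' ginf. c > 0 \<and> c' > 0 \<and> ginf \<ge> 1 \<and>
      (\<forall>x\<in>\<Omega>. \<forall>y\<in>\<Omega>. \<bar>g x - g y\<bar> \<le> c / ln (exp 1 + 1 / norm (x - y))) \<and>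
      (\<forall>x\<in>\<Omega>. \<bar>g x - ginf\<bar> \<le> c' / ln (exp 1 + norm x)))"

text \<open>
  The inequality \<open>ess_inf_on \<Omega> g \<le> ess_sup_on \<Omega> g\<close> is automatic when \<open>\<Omega>\<close> has positive measure;
  it is left out so that the empty set is not excluded.
\<close>

definition P0_log :: "(real ^ 'n) set \<Rightarrow> (real ^ 'n \<Rightarrow> real) set" where
  "P0_log \<Omega> = {g. (\<forall>x\<in>\<Omega>. 0 < g x) \<and> log_Holder_on \<Omega> g \<and>
                   0 < ess_inf_on \<Omega> g \<and> ess_sup_on \<Omega> g < \<infinity>}"

definition P1_log :: "(real ^ 'n) set \<Rightarrow> (real ^ 'n \<Rightarrow> real) set" where
  "P1_log \<Omega> = {g \<in> P0_log \<Omega>. 1 \<le> ess_inf_on \<Omega> g}"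

definition modular :: "(real ^ 'n) set \<Rightarrow> (real ^ 'n \<Rightarrow> real) \<Rightarrow> (real ^ 'n \<Rightarrow> real) \<Rightarrow> ennreal" where
  "modular \<Omega> s f = (\<integral>\<^sup>+ x. ennreal (\<bar>f x\<bar> powr s x) \<partial>lebesgue_on \<Omega>)"

definition var_Lspace :: "(real ^ 'n) set \<Rightarrow> (real ^ 'n \<Rightarrow> real) \<Rightarrow> (real ^ 'n \<Rightarrow> real) set" where
  "var_Lspace \<Omega> s = {f. f \<in> borel_measurable (lebesgue_on \<Omega>) \<and> modular \<Omega> s f < \<infinity>}"

text \<open>The value is \<open>\<infinity>\<close> if no \<open>l\<close> is admissible.\<close>

definition Luxemburg_norm ::
    "(real ^ 'n) set \<Rightarrow> (real ^ 'n \<Rightarrow> real) \<Rightarrow> (real ^ 'n \<Rightarrow> real) \<Rightarrow> ennreal" where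
  "Luxemburg_norm \<Omega> s f = Inf {ennreal l | l. 0 < l \<and> modular \<Omega> s (\<lambda>x. f x / l) \<le> 1}"

text \<open>
  The weak space consists of extended-real-valued functions, because a Riesz potential may take
  the value \<open>\<infinity>\<close>; membership forces finiteness almost everywhere.
\<close>

definition weak_var_Lspace :: "(real ^ 'n) set \<Rightarrow> (real ^ 'n \<Rightarrow> real) \<Rightarrow> (real ^ 'n \<Rightarrow> ereal) set" where
  "weak_var_Lspace \<Omega> s =
    {F. F \<in> borel_measurable (lebesgue_on \<Omega>) \<and>
        (SUP l\<in>{0<..}. ennreal l * Luxemburg_norm \<Omega> s (indicator {x \<in> \<Omega>. ereal l < \<bar>F x\<bar>})) < \<infinity>}"

text \<open>The integrand is irrelevant at the single point \<open>y = x\<close>, a null set.\<close>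

definition Riesz_potential ::
    "(real ^ 'n) set \<Rightarrow> (real ^ 'n \<Rightarrow> real) \<Rightarrow> (real ^ 'n \<Rightarrow> real) \<Rightarrow> real ^ 'n \<Rightarrow> ereal" where
  "Riesz_potential \<Omega> \<alpha> f x =
    enn2ereal (\<integral>\<^sup>+ y. ennreal (\<bar>f y\<bar> / norm (x - y) powr (real CARD('n) - \<alpha> y)) \<partial>lebesgue_on \<Omega>)"

definition Sobolev_conjugate ::
    "(real ^ 'n \<Rightarrow> real) \<Rightarrow> (real ^ 'n \<Rightarrow> real) \<Rightarrow> real ^ 'n \<Rightarrow> real" where
  "Sobolev_conjugate \<alpha> p x = real CARD('n) * p x / (real CARD('n) - \<alpha> x * p x)"

text \<open>Real powers on \<open>[0, \<infinity>]\<close>, meant for positive exponents, with \<open>\<infinity>\<close> raised to \<open>a\<close> equal to \<open>\<infinity>\<close>.\<close>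

definition ereal_powr :: "ereal \<Rightarrow> real \<Rightarrow> ereal" where
  "ereal_powr t a = (if t = \<infinity> then \<infinity> else ereal (real_of_ereal t powr a))"

end

theory Submission
  imports Defs
begin

text \<open>
  Let \<open>N\<close> be the dimension, \<open>S\<close> the Sobolev conjugate of \<open>p\<close>, \<open>s = S / q\<close>, and let the mass of a ball be the
  integral of \<open>\<bar>f\<bar> powr p\<close> over its intersection with \<open>\<Omega>\<close>. Membership in the weak space amounts to a bound,
  uniform in \<open>l\<close>, for the integral of \<open>l powr s\<close> over the set \<open>E\<close> where the power \<open>q\<close> of the Riesz potential
  exceeds \<open>l\<close> (\<open>weak_var_LspaceI\<close>). As \<open>\<Omega>\<close> has finite measure and \<open>s\<close> is bounded, only large \<open>l\<close> matter.

  The first step is a pointwise estimate in the manner of Hedberg (\<open>Hedberg_bound\<close>): if every ball around \<open>x\<close> of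
  radius \<open>t\<close> has mass at most \<open>A * t powr N\<close>, where \<open>A \<ge> 1\<close>, then the Riesz potential at \<open>x\<close> is at most a constant
  times \<open>A powr (1 / S x)\<close>. Instead of averages and Hoelder's inequality it uses the splitting
  \<open>\<bar>f\<bar> \<le> \<tau> + \<tau> powr (1 - p) * \<bar>f\<bar> powr p\<close> with a level \<open>\<tau>\<close> that depends on the distance to \<open>x\<close>.
  Consequently every point of \<open>E\<close> is the centre of a ball whose mass exceeds a constant times
  \<open>l powr s x * t powr N\<close> (\<open>Riesz_superlevel_large_mass_ball\<close>).

  The second step is the weak type inequality for the maximal function, by Vitali's covering lemma
  (\<open>variable_weak_type_estimate\<close>): the disjoint balls of a Vitali subfamily have total mass at most that of
  \<open>\<Omega>\<close>, and each controls the integral of \<open>l powr s\<close> over its fivefold enlargement. Applying it directly to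
  the superlevel sets of the potential avoids a pointwise comparison of \<open>f\<close> with its maximal function and
  covers the endpoint where \<open>p\<close> takes the value 1.

  In both steps variable exponents are moved between nearby points by logarithmic Hoelder continuity. This is
  possible whenever the base is comparable with powers of the distance (\<open>powr_change_exponent\<close>): in the first step
  the base is the distance itself or the level \<open>\<tau>\<close>; in the second it is \<open>l\<close>, which cannot exceed a power of
  \<open>1 / t\<close> on a ball of radius \<open>t\<close> with large mass, since the total mass is finite.
\<close>

section \<open>Logarithmic Hoelder continuity\<close>

text \<open>
  The reciprocal of the modulus of continuity in the logarithmic Hoelder condition. Every estimate
  below multiplies by it instead of dividing by a logarithm.
\<close>

definition log_modulus :: "real \<Rightarrow> real" where
  "log_modulus d = ln (exp 1 + 1 / d)"

lemma log_modulus_ge_1: "0 \<le> d \<Longrightarrow> 1 \<le> log_modulus d"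
  unfolding log_modulus_def by (subst ln_ge_iff) (auto intro: add_pos_nonneg)

lemma abs_ln_le_log_modulus:
  assumes "0 < d" "d \<le> D" "1 \<le> D"
  shows "\<bar>ln d\<bar> \<le> (1 + ln D) * log_modulus d"
proof -
  have m: "1 \<le> log_modulus d" using assms by (simp add: log_modulus_ge_1)
  have D0: "0 \<le> ln D" using assms by simp
  have "- ln d = ln (1 / d)" using assms by (simp add: ln_div)
  also have "\<dots> \<le> log_modulus d" unfolding log_modulus_def
    using assms by (subst ln_le_cancel_iff) (auto intro: add_pos_pos)
  finally have "- ln d \<le> (1 + ln D) * log_modulus d" 
    using mult_nonneg_nonneg[OF D0, of "log_modulus d"] m by (simp add: algebra_simps)
  moreover have "ln d \<le> ln D * 1" using assms by simp
  then have "ln d \<le> (1 + ln D) * log_modulus d"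
    using mult_left_mono[OF m D0] m by (simp add: algebra_simps)
  ultimately show ?thesis by linarith
qed

text \<open>
  The quantitative use of logarithmic Hoelder continuity: a base that is between powers of the
  distance, up to constants, may have its exponent evaluated at a neighbouring point at the cost of a
  constant factor, because \<open>\<bar>u - v\<bar> \<bar>ln t\<bar>\<close> is bounded. Here \<open>m\<close> is the logarithmic modulus of the
  distance between the two points.
\<close>

lemma powr_change_exponent:
  fixes t u v m L a :: real
  assumes t: "0 < t" and uv: "\<bar>u - v\<bar> * m \<le> L" and ln: "\<bar>ln t\<bar> \<le> a * m" and a: "0 \<le> a"
  shows "t powr v \<le> exp (a * L) * t powr u"
proof -
  have "(v - u) * ln t \<le> \<bar>v - u\<bar> * \<bar>ln t\<bar>"
    by (metis abs_ge_self abs_mult)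
  also have "\<dots> \<le> \<bar>v - u\<bar> * (a * m)" using ln by (rule mult_left_mono) simp
  also have "\<dots> = a * (\<bar>u - v\<bar> * m)" by (simp add: abs_minus_commute)
  also have "\<dots> \<le> a * L" using uv a by (rule mult_left_mono)
  finally have "v * ln t \<le> a * L + u * ln t" by (simp add: algebra_simps)
  then show ?thesis using t by (simp add: powr_def flip: exp_add)
qed

text \<open>
  The condition on nearby points without the decay condition at infinity. Exponents such as
  \<open>Sobolev_conjugate \<alpha> p x / q x\<close> are built from the given ones by products and reciprocals; this form
  is stable under these operations, whereas a limit at infinity that is at least 1 need not survive.
\<close>

definition loc_log_Holder_on :: "(real ^ 'n) set \<Rightarrow> (real ^ 'n \<Rightarrow> real) \<Rightarrow> bool" where
  "loc_log_Holder_on \<Omega> g \<longleftrightarrow>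
     (\<exists>L\<ge>0. \<forall>x\<in>\<Omega>. \<forall>y\<in>\<Omega>. \<bar>g x - g y\<bar> * log_modulus (dist x y) \<le> L)"

lemma loc_log_Holder_onI:
  assumes "\<And>x y. x \<in> \<Omega> \<Longrightarrow> y \<in> \<Omega> \<Longrightarrow> \<bar>g x - g y\<bar> * log_modulus (dist x y) \<le> L"
  shows "loc_log_Holder_on \<Omega> g"
  unfolding loc_log_Holder_on_def
  using assms by (intro exI[of _ "max 0 L"]) (auto intro: max.coboundedI2)

lemma log_Holder_on_imp_loc:
  assumes "log_Holder_on \<Omega> g"
  shows "loc_log_Holder_on \<Omega> g"
proof -
  obtain c where c: "\<And>x y. x \<in> \<Omega> \<Longrightarrow> y \<in> \<Omega> \<Longrightarrow> \<bar>g x - g y\<bar> \<le> c / log_modulus (dist x y)"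
    using assms unfolding log_Holder_on_def log_modulus_def dist_norm by blast
  show ?thesis
  proof (rule loc_log_Holder_onI)
    fix x y assume "x \<in> \<Omega>" "y \<in> \<Omega>"
    moreover have "1 \<le> log_modulus (dist x y)" by (simp add: log_modulus_ge_1)
    ultimately show "\<bar>g x - g y\<bar> * log_modulus (dist x y) \<le> c"
      using c[of x y] by (simp add: field_simps)
  qed
qed

lemma log_Holder_on_imp_bounded:
  assumes "log_Holder_on \<Omega> g"
  obtains B where "0 < B" "\<And>x. x \<in> \<Omega> \<Longrightarrow> \<bar>g x\<bar> \<le> B"
proof -
  obtain c' l where c: "0 < c'" "1 \<le> l"
    and g: "\<And>x. x \<in> \<Omega> \<Longrightarrow> \<bar>g x - l\<bar> \<le> c' / ln (exp 1 + norm x)"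
    using assms unfolding log_Holder_on_def by blast
  show ?thesis
  proof
    show "0 < c' + l" using c by simp
    fix x assume x: "x \<in> \<Omega>"
    have "1 \<le> ln (exp 1 + norm x)"
      by (subst ln_ge_iff) (auto intro: add_pos_nonneg)
    then have "c' / ln (exp 1 + norm x) \<le> c' / 1"
      using c by (intro divide_left_mono) auto
    with g[OF x] c show "\<bar>g x\<bar> \<le> c' + l" by linarith
  qed
qed

lemma loc_log_Holder_on_mult:
  assumes f: "loc_log_Holder_on \<Omega> f" "\<And>x. x \<in> \<Omega> \<Longrightarrow> \<bar>f x\<bar> \<le> B"
    and g: "loc_log_Holder_on \<Omega> g" "\<And>x. x \<in> \<Omega> \<Longrightarrow> \<bar>g x\<bar> \<le> B'"
  shows "loc_log_Holder_on \<Omega> (\<lambda>x. f x * g x)"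
proof -
  obtain L where L: "0 \<le> L"
    "\<And>x y. x \<in> \<Omega> \<Longrightarrow> y \<in> \<Omega> \<Longrightarrow> \<bar>f x - f y\<bar> * log_modulus (dist x y) \<le> L"
    using f(1) unfolding loc_log_Holder_on_def by blast
  obtain L' where L': "0 \<le> L'"
    "\<And>x y. x \<in> \<Omega> \<Longrightarrow> y \<in> \<Omega> \<Longrightarrow> \<bar>g x - g y\<bar> * log_modulus (dist x y) \<le> L'"
    using g(1) unfolding loc_log_Holder_on_def by blast
  show ?thesis
  proof (rule loc_log_Holder_onI)
    fix x y assume xy: "x \<in> \<Omega>" "y \<in> \<Omega>"
    let ?m = "log_modulus (dist x y)"
    have m: "0 \<le> ?m" using log_modulus_ge_1[of "dist x y"] by simp
    have "f x * g x - f y * g y = f x * (g x - g y) + (f x - f y) * g y"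
      by (simp add: algebra_simps)
    also have "\<bar>\<dots>\<bar> \<le> \<bar>f x\<bar> * \<bar>g x - g y\<bar> + \<bar>f x - f y\<bar> * \<bar>g y\<bar>"
      by (metis abs_mult abs_triangle_ineq)
    finally have "\<bar>f x * g x - f y * g y\<bar> * ?m
        \<le> (\<bar>f x\<bar> * \<bar>g x - g y\<bar> + \<bar>f x - f y\<bar> * \<bar>g y\<bar>) * ?m"
      using m by (rule mult_right_mono)
    also have "\<dots> = \<bar>f x\<bar> * (\<bar>g x - g y\<bar> * ?m) + (\<bar>f x - f y\<bar> * ?m) * \<bar>g y\<bar>"
      by (simp add: algebra_simps)
    also have "\<dots> \<le> B * L' + L * B'"
      using f(2)[OF xy(1)] g(2)[OF xy(2)] L(1) L(2)[OF xy] L'(1) L'(2)[OF xy] m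
      by (intro add_mono mult_mono) auto
    finally show "\<bar>f x * g x - f y * g y\<bar> * ?m \<le> B * L' + L * B'" .
  qed
qed

lemma loc_log_Holder_on_inverse:
  assumes g: "loc_log_Holder_on \<Omega> g" and b: "0 < b" "\<And>x. x \<in> \<Omega> \<Longrightarrow> b \<le> g x"
  shows "loc_log_Holder_on \<Omega> (\<lambda>x. 1 / g x)"
proof -
  obtain L where L: "0 \<le> L"
    "\<And>x y. x \<in> \<Omega> \<Longrightarrow> y \<in> \<Omega> \<Longrightarrow> \<bar>g x - g y\<bar> * log_modulus (dist x y) \<le> L"
    using g(1) unfolding loc_log_Holder_on_def by blast
  show ?thesis
  proof (rule loc_log_Holder_onI)
    fix x y assume xy: "x \<in> \<Omega>" "y \<in> \<Omega>"
    let ?m = "log_modulus (dist x y)"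
    have gx: "b \<le> g x" "b \<le> g y" using b(2) xy by auto
    then have bb: "b * b \<le> g x * g y" using b by (intro mult_mono) auto
    have "1 / g x - 1 / g y = (g y - g x) / (g x * g y)"
      using gx b by (simp add: field_simps)
    then have "\<bar>1 / g x - 1 / g y\<bar> * ?m = (\<bar>g x - g y\<bar> * ?m) / (g x * g y)"
      using gx b by (simp add: abs_mult abs_minus_commute)
    also have "\<dots> \<le> L / (b * b)"
      using L(1) L(2)[OF xy] bb b by (intro frac_le) auto
    finally show "\<bar>1 / g x - 1 / g y\<bar> * ?m \<le> L / (b * b)" .
  qed
qed

lemma loc_log_Holder_on_cmult:
  assumes "loc_log_Holder_on \<Omega> g"
  shows "loc_log_Holder_on \<Omega> (\<lambda>x. c * g x)"
proof -
  obtain L where L: "\<And>x y. x \<in> \<Omega> \<Longrightarrow> y \<in> \<Omega> \<Longrightarrow> \<bar>g x - g y\<bar> * log_modulus (dist x y) \<le> L"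
    using assms unfolding loc_log_Holder_on_def by blast
  show ?thesis
  proof (rule loc_log_Holder_onI)
    fix x y assume "x \<in> \<Omega>" "y \<in> \<Omega>"
    from mult_left_mono[OF L[OF this], of "\<bar>c\<bar>"]
    show "\<bar>c * g x - c * g y\<bar> * log_modulus (dist x y) \<le> \<bar>c\<bar> * L"
      by (simp add: abs_mult mult.assoc flip: right_diff_distrib)
  qed
qed

lemma loc_log_Holder_on_const_diff:
  assumes "loc_log_Holder_on \<Omega> g"
  shows "loc_log_Holder_on \<Omega> (\<lambda>x. c - g x)"
  using assms unfolding loc_log_Holder_on_def by (simp add: abs_minus_commute)

lemma loc_log_Holder_on_imp_continuous_on:
  assumes "loc_log_Holder_on \<Omega> g"
  shows "continuous_on \<Omega> g"
  unfolding continuous_on_iff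
proof safe
  obtain L where L: "0 \<le> L"
    "\<And>x y. x \<in> \<Omega> \<Longrightarrow> y \<in> \<Omega> \<Longrightarrow> \<bar>g x - g y\<bar> * log_modulus (dist x y) \<le> L"
    using assms unfolding loc_log_Holder_on_def by blast
  fix x and e :: real assume x: "x \<in> \<Omega>" and e: "0 < e"
  show "\<exists>d>0. \<forall>y\<in>\<Omega>. dist y x < d \<longrightarrow> dist (g y) (g x) < e"
  proof (intro exI[of _ "exp (- (L / e))"] conjI ballI impI)
    fix y assume y: "y \<in> \<Omega>" "dist y x < exp (- (L / e))"
    show "dist (g y) (g x) < e"
    proof (cases "y = x")
      case False
      define m where "m = log_modulus (dist x y)"
      have d: "0 < dist x y" using False by simp
      have "ln (dist x y) < - (L / e)"
        using y d by (metis dist_commute exp_less_cancel_iff exp_ln)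
      then have "L / e < ln (1 / dist x y)" using d by (simp add: ln_div)
      also have "\<dots> \<le> m" unfolding m_def log_modulus_def
        using d by (subst ln_le_cancel_iff) (auto intro: add_pos_pos)
      finally have "L < e * m" using e by (simp add: field_simps)
      moreover have "\<bar>g x - g y\<bar> * m \<le> L" using L(2)[OF x y(1)] by (simp add: m_def)
      ultimately have "\<bar>g x - g y\<bar> * m < e * m" by linarith
      moreover have "0 < m" using log_modulus_ge_1[of "dist x y"] by (simp add: m_def)
      ultimately show ?thesis by (simp add: dist_real_def abs_minus_commute)
    qed (use e in simp)
  qed simp
qed

section \<open>From essential to pointwise bounds\<close>

text \<open>
  The exceptional set is open by continuity and null, hence empty. This turns the essential bounds on
  the exponents into bounds at every point of \<open>\<Omega>\<close>.
\<close>

lemma AE_le_imp_le_on_open: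
  fixes g :: "real ^ 'n \<Rightarrow> real"
  assumes \<Omega>: "open \<Omega>" and g: "continuous_on \<Omega> g" and ae: "AE x in lebesgue_on \<Omega>. g x \<le> b"
    and x: "x \<in> \<Omega>"
  shows "g x \<le> b"
proof -
  have "open (g -` {b<..} \<inter> \<Omega>)"
    using continuous_on_open_vimage[OF \<Omega>, of g] g open_greaterThan[of b] by blast
  also have "g -` {b<..} \<inter> \<Omega> = {x \<in> \<Omega>. b < g x}" by auto
  finally have op: "open {x \<in> \<Omega>. b < g x}" .
  have "{x \<in> \<Omega>. b < g x} \<in> null_sets lebesgue"
  proof -
    have "AE x in lebesgue. x \<in> \<Omega> \<longrightarrow> g x \<le> b"
      using ae \<Omega> by (simp add: AE_restrict_space_iff)
    then have "AE x in lebesgue. x \<notin> {x \<in> \<Omega>. b < g x}" by eventually_elim auto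
    then show ?thesis using op by (subst AE_iff_null_sets) auto
  qed
  with op have "{x \<in> \<Omega>. b < g x} = {}"
    using open_not_negligible negligible_iff_null_sets by blast
  then show ?thesis using x by force
qed

lemma le_of_ess_sup_on_less:
  fixes g :: "real ^ 'n \<Rightarrow> real"
  assumes "open \<Omega>" "continuous_on \<Omega> g" "ess_sup_on \<Omega> g < ereal b" "x \<in> \<Omega>"
  shows "g x \<le> b"
proof (rule AE_le_imp_le_on_open[OF assms(1,2) _ assms(4)])
  have "AE x in lebesgue_on \<Omega>. ereal (g x) \<le> ess_sup_on \<Omega> g"
    unfolding ess_sup_on_def by (rule esssup_AE)
  then show "AE x in lebesgue_on \<Omega>. g x \<le> b"
  proof eventually_elim
    case (elim x)
    then have "ereal (g x) < ereal b" using assms(3) by (rule le_less_trans)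
    then show ?case by simp
  qed
qed

lemma ge_of_less_ess_inf_on:
  fixes g :: "real ^ 'n \<Rightarrow> real"
  assumes "open \<Omega>" "continuous_on \<Omega> g" "ereal b < ess_inf_on \<Omega> g" "x \<in> \<Omega>"
  shows "b \<le> g x"
proof -
  obtain z where z: "ereal b < z" "AE x in lebesgue_on \<Omega>. z \<le> ereal (g x)"
    using assms(3) unfolding ess_inf_on_def less_Sup_iff by blast
  have "AE x in lebesgue_on \<Omega>. - g x \<le> - b"
    using z(2)
  proof eventually_elim
    case (elim x)
    with z(1) have "ereal b < ereal (g x)" by (rule less_le_trans)
    then show ?case by simp
  qed
  then have "- g x \<le> - b"
    using assms by (intro AE_le_imp_le_on_open[of \<Omega> "\<lambda>x. - g x"]) (auto intro: continuous_on_minus)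
  then show ?thesis by simp
qed

section \<open>Integrals of power kernels against measures of controlled growth\<close>

lemma indicator_cball_borel_measurable:
  fixes x :: "'a::metric_space"
  assumes [measurable]: "dist x \<in> borel_measurable M"
  shows "(\<lambda>y. indicator (cball x t) y :: ennreal) \<in> borel_measurable M"
    and "(\<lambda>y. indicator (- cball x t) y :: ennreal) \<in> borel_measurable M"
proof -
  have "(\<lambda>y. indicator {..t} (dist x y) :: ennreal) \<in> borel_measurable M"
    "(\<lambda>y. indicator {t<..} (dist x y) :: ennreal) \<in> borel_measurable M" by measurable
  then show "(\<lambda>y. indicator (cball x t) y :: ennreal) \<in> borel_measurable M"
    "(\<lambda>y. indicator (- cball x t) y :: ennreal) \<in> borel_measurable M"
    by (simp_all add: indicator_def not_le)
qed

text \<open>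
  On the shell \<open>r j / 2 < dist x y \<le> r j\<close> the kernel is comparable to \<open>r j powr (\<sigma> - N)\<close>, and the shell
  has mass at most \<open>A * r j powr N\<close>, so it contributes a multiple of \<open>A * r j powr \<sigma>\<close>. The radii are left
  arbitrary so that the estimate serves both for radii shrinking to 0 (with \<open>\<sigma> > 0\<close>) and for radii growing
  to infinity (with \<open>\<sigma> < 0\<close>).
\<close>

lemma nn_integral_dyadic_shells:
  fixes x :: "'a::metric_space" and w :: "'a \<Rightarrow> ennreal" and r :: "nat \<Rightarrow> real"
  assumes w[measurable]: "w \<in> borel_measurable M" and d[measurable]: "dist x \<in> borel_measurable M"
    and growth: "\<And>t. 0 < t \<Longrightarrow> (\<integral>\<^sup>+y. w y * indicator (cball x t) y \<partial>M) \<le> ennreal (A * t powr N)"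
    and A: "0 \<le> A" and \<sigma>: "\<sigma> \<le> N" and r: "\<And>j. 0 < r j" and S: "(\<lambda>j. r j powr \<sigma>) sums S"
    and E: "\<And>y. y \<in> E \<Longrightarrow> \<exists>j. r j / 2 < dist x y \<and> dist x y \<le> r j"
  shows "(\<integral>\<^sup>+y. w y * ennreal (dist x y powr (\<sigma> - N)) * indicator E y \<partial>M)
           \<le> ennreal (2 powr (N - \<sigma>) * A * S)"
proof -
  define h where "h j y = ennreal ((r j / 2) powr (\<sigma> - N)) * (w y * indicator (cball x (r j)) y)" for j y
  note indicator_cball_borel_measurable[OF d, measurable]
  have h[measurable]: "h j \<in> borel_measurable M" for j
    unfolding h_def by measurable
  have "(\<integral>\<^sup>+y. w y * ennreal (dist x y powr (\<sigma> - N)) * indicator E y \<partial>M) \<le> (\<integral>\<^sup>+y. (\<Sum>j. h j y) \<partial>M)"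
  proof (rule nn_integral_mono)
    fix y
    show "w y * ennreal (dist x y powr (\<sigma> - N)) * indicator E y \<le> (\<Sum>j. h j y)"
    proof (cases "y \<in> E")
      case True
      then obtain j where j: "r j / 2 < dist x y" "dist x y \<le> r j" using E by blast
      have "dist x y powr (\<sigma> - N) \<le> (r j / 2) powr (\<sigma> - N)"
        using j r[of j] \<sigma> by (intro powr_mono2') auto
      then have "w y * ennreal (dist x y powr (\<sigma> - N)) * indicator E y \<le> h j y"
        unfolding h_def using True j
        by (simp add: mult.commute[of "w y"] mult_right_mono ennreal_leI)
      also have "\<dots> = (\<Sum>i\<in>{j}. h i y)" by simp
      also have "\<dots> \<le> (\<Sum>j. h j y)" by (intro sum_le_suminf) auto
      finally show ?thesis .
    qed simp
  qed
  also have "\<dots> = (\<Sum>j. \<integral>\<^sup>+y. h j y \<partial>M)"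
    by (rule nn_integral_suminf) simp
  also have "\<dots> \<le> (\<Sum>j. ennreal (2 powr (N - \<sigma>) * A * r j powr \<sigma>))"
  proof (rule suminf_le)
    fix j
    have "(\<integral>\<^sup>+y. h j y \<partial>M) = ennreal ((r j / 2) powr (\<sigma> - N)) * (\<integral>\<^sup>+y. w y * indicator (cball x (r j)) y \<partial>M)"
      unfolding h_def by (subst nn_integral_cmult) auto
    also have "\<dots> \<le> ennreal ((r j / 2) powr (\<sigma> - N)) * ennreal (A * r j powr N)"
      by (intro mult_left_mono growth r) auto
    also have "\<dots> = ennreal ((r j / 2) powr (\<sigma> - N) * (A * r j powr N))"
      using A by (simp add: ennreal_mult')
    also have "(r j / 2) powr (\<sigma> - N) * (A * r j powr N) = 2 powr (N - \<sigma>) * A * r j powr \<sigma>"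
    proof -
      have "(r j / 2) powr (\<sigma> - N) = r j powr (\<sigma> - N) * 2 powr (N - \<sigma>)"
        using r[of j] by (simp add: powr_divide powr_diff field_simps)
      moreover have "r j powr (\<sigma> - N) * r j powr N = r j powr \<sigma>"
        by (simp flip: powr_add)
      ultimately show ?thesis by (metis mult.assoc mult.commute)
    qed
    finally show "(\<integral>\<^sup>+y. h j y \<partial>M) \<le> ennreal (2 powr (N - \<sigma>) * A * r j powr \<sigma>)" .
  qed auto
  also have "\<dots> = ennreal (2 powr (N - \<sigma>) * A * S)"
    using A by (intro suminf_ennreal_eq sums_mult S) auto
  finally show ?thesis .
qed

lemma geometric_radii_sums:
  fixes \<rho> s :: real
  assumes "0 < \<rho>" "0 < b" "b \<le> s"
  shows "\<exists>S. (\<lambda>j. (\<rho> / 2 ^ j) powr s) sums S \<and> S \<le> \<rho> powr s / (1 - 2 powr - b)"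
    and "\<exists>S. (\<lambda>j. (\<rho> * 2 ^ j) powr - s) sums S \<and> S \<le> \<rho> powr - s / (1 - 2 powr - b)"
proof -
  define z where "z = 2 powr - s"
  have z: "0 < z" "z \<le> 2 powr - b" using assms by (auto simp: z_def)
  have b: "2 powr - b < (1::real)" using assms powr_less_cancel_iff[of 2 "-b" 0] by simp
  have geo: "(\<lambda>j. c * z ^ j) sums (c * (1 / (1 - z)))" for c
    using z b by (intro sums_mult geometric_sums) auto
  have le: "c * (1 / (1 - z)) \<le> c / (1 - 2 powr - b)" if "0 \<le> c" for c
    using that z b by (simp add: frac_le)
  have eq: "(\<rho> / 2 ^ j) powr s = \<rho> powr s * z ^ j" "(\<rho> * 2 ^ j) powr - s = \<rho> powr - s * z ^ j" for j :: nat
  proof -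
    have "(2 ^ j) powr s = (2 powr s) ^ j"
      by (simp add: powr_powr mult.commute flip: powr_realpow powr_power)
    moreover have "z = 1 / 2 powr s" by (simp add: z_def powr_minus_divide)
    ultimately show "(\<rho> / 2 ^ j) powr s = \<rho> powr s * z ^ j" "(\<rho> * 2 ^ j) powr - s = \<rho> powr - s * z ^ j"
      using assms by (simp_all add: powr_divide powr_mult powr_minus_divide power_divide)
  qed
  show "\<exists>S. (\<lambda>j. (\<rho> / 2 ^ j) powr s) sums S \<and> S \<le> \<rho> powr s / (1 - 2 powr - b)"
    unfolding eq using geo[of "\<rho> powr s"] le[of "\<rho> powr s"] by (auto simp del: times_divide_eq_right)
  show "\<exists>S. (\<lambda>j. (\<rho> * 2 ^ j) powr - s) sums S \<and> S \<le> \<rho> powr - s / (1 - 2 powr - b)"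
    unfolding eq using geo[of "\<rho> powr - s"] le[of "\<rho> powr - s"] by (auto simp del: times_divide_eq_right)
qed

text \<open>
  The bound \<open>b\<close> keeps the constant uniform when the exponent \<open>s\<close> varies with the centre \<open>x\<close>. The centre
  itself, which lies in no shell, contributes nothing because \<open>0 powr a = 0\<close>.
\<close>

lemma nn_integral_potential_near:
  fixes x :: "'a::metric_space" and w :: "'a \<Rightarrow> ennreal"
  assumes "w \<in> borel_measurable M" and "dist x \<in> borel_measurable M"
    and "\<And>t. 0 < t \<Longrightarrow> (\<integral>\<^sup>+y. w y * indicator (cball x t) y \<partial>M) \<le> ennreal (A * t powr N)"
    and A: "0 \<le> A" and \<rho>: "0 < \<rho>" and b: "0 < b" "b \<le> s" "s \<le> N"
  shows "(\<integral>\<^sup>+y. w y * ennreal (dist x y powr (s - N)) * indicator (cball x \<rho>) y \<partial>M)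
           \<le> ennreal (2 powr N / (1 - 2 powr - b) * A * \<rho> powr s)"
proof -
  obtain S where S: "(\<lambda>j. (\<rho> / 2 ^ j) powr s) sums S" "S \<le> \<rho> powr s / (1 - 2 powr - b)"
    using geometric_radii_sums(1)[OF \<rho> b(1,2)] by blast
  have *: "\<exists>j. \<rho> / 2 ^ j / 2 < dist x y \<and> dist x y \<le> \<rho> / 2 ^ j" if "y \<in> cball x \<rho> - {x}" for y
  proof -
    have d: "0 < dist x y" "dist x y \<le> \<rho>" using that by auto
    obtain k :: nat where "\<rho> / dist x y < 2 ^ k" using real_arch_pow[of 2 "\<rho> / dist x y"] by auto
    then have ex: "\<exists>k. \<rho> / 2 ^ k < dist x y" using d by (auto simp: field_simps)
    define k where "k = (LEAST k. \<rho> / 2 ^ k < dist x y)"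
    have k: "\<rho> / 2 ^ k < dist x y" unfolding k_def using ex by (rule LeastI_ex)
    then obtain j where j: "k = Suc j" using d by (cases k) auto
    then have "\<not> \<rho> / 2 ^ j < dist x y" unfolding k_def using not_less_Least[of j] j by (metis k_def lessI)
    with k j show ?thesis by (intro exI[of _ j]) (auto simp: field_simps)
  qed
  have "(\<integral>\<^sup>+y. w y * ennreal (dist x y powr (s - N)) * indicator (cball x \<rho>) y \<partial>M)
        = (\<integral>\<^sup>+y. w y * ennreal (dist x y powr (s - N)) * indicator (cball x \<rho> - {x}) y \<partial>M)"
    by (intro nn_integral_cong) (auto simp: indicator_def)
  also have "\<dots> \<le> ennreal (2 powr (N - s) * A * S)"
    by (rule nn_integral_dyadic_shells[where r = "\<lambda>j. \<rho> / 2 ^ j", OF assms(1-4) b(3) _ S(1) *])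
      (use \<rho> in auto)
  also have "\<dots> \<le> ennreal (2 powr N * A * (\<rho> powr s / (1 - 2 powr - b)))"
  proof (intro ennreal_leI mult_mono S(2))
    show "2 powr (N - s) \<le> (2 powr N :: real)" using b by simp
    show "0 \<le> S" using S(1) by (rule sums_le[OF _ sums_zero, rotated]) simp
  qed (use A in auto)
  also have "2 powr N * A * (\<rho> powr s / (1 - 2 powr - b)) = 2 powr N / (1 - 2 powr - b) * A * \<rho> powr s"
    by simp
  finally show ?thesis .
qed

lemma nn_integral_potential_far:
  fixes x :: "'a::metric_space" and w :: "'a \<Rightarrow> ennreal"
  assumes "w \<in> borel_measurable M" and "dist x \<in> borel_measurable M"
    and "\<And>t. 0 < t \<Longrightarrow> (\<integral>\<^sup>+y. w y * indicator (cball x t) y \<partial>M) \<le> ennreal (A * t powr N)"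
    and A: "0 \<le> A" and \<rho>: "0 < \<rho>" and b: "0 < b" "b \<le> s" "s \<le> N"
  shows "(\<integral>\<^sup>+y. w y * ennreal (dist x y powr (- s - N)) * indicator (- cball x \<rho>) y \<partial>M)
           \<le> ennreal (4 powr N / (1 - 2 powr - b) * A * \<rho> powr - s)"
proof -
  obtain S where S: "(\<lambda>j. (\<rho> * 2 ^ j) powr - s) sums S" "S \<le> \<rho> powr - s / (1 - 2 powr - b)"
    using geometric_radii_sums(2)[OF \<rho> b(1,2)] by blast
  have *: "\<exists>j. \<rho> * 2 ^ j / 2 < dist x y \<and> dist x y \<le> \<rho> * 2 ^ j" if "y \<in> - cball x \<rho>" for y
  proof -
    have d: "\<rho> < dist x y" using that by auto
    obtain k :: nat where "dist x y / \<rho> < 2 ^ k" using real_arch_pow[of 2 "dist x y / \<rho>"] by auto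
    then have ex: "\<exists>k. dist x y \<le> \<rho> * 2 ^ k" using \<rho> by (auto simp: field_simps intro: less_imp_le)
    define k where "k = (LEAST k. dist x y \<le> \<rho> * 2 ^ k)"
    have k: "dist x y \<le> \<rho> * 2 ^ k" unfolding k_def using ex by (rule LeastI_ex)
    then obtain j where j: "k = Suc j" using d by (cases k) auto
    then have "\<not> dist x y \<le> \<rho> * 2 ^ j" unfolding k_def using not_less_Least[of j] j by (metis k_def lessI)
    with k j show ?thesis by (intro exI[of _ k]) auto
  qed
  have "(\<integral>\<^sup>+y. w y * ennreal (dist x y powr (- s - N)) * indicator (- cball x \<rho>) y \<partial>M)
        \<le> ennreal (2 powr (N - - s) * A * S)"
    by (rule nn_integral_dyadic_shells[where r = "\<lambda>j. \<rho> * 2 ^ j", OF assms(1-4) _ _ S(1) *])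
      (use \<rho> b in auto)
  also have "\<dots> \<le> ennreal (4 powr N * A * (\<rho> powr - s / (1 - 2 powr - b)))"
  proof (intro ennreal_leI mult_mono S(2))
    have "2 powr (N - - s) \<le> (2 powr (N + N) :: real)" using b by (intro powr_mono) auto
    also have "\<dots> = (2 * 2) powr N" by (simp only: powr_add powr_mult)
    finally show "2 powr (N - - s) \<le> (4 powr N :: real)" by simp
    show "0 \<le> S" using S(1) by (rule sums_le[OF _ sums_zero, rotated]) simp
  qed (use A in auto)
  also have "4 powr N * A * (\<rho> powr - s / (1 - 2 powr - b)) = 4 powr N / (1 - 2 powr - b) * A * \<rho> powr - s"
    by simp
  finally show ?thesis .
qed

lemma abs_le_level_plus_power:
  fixes u \<tau> q :: real
  assumes "0 < \<tau>" "1 \<le> q"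
  shows "\<bar>u\<bar> \<le> \<tau> + \<tau> powr (1 - q) * \<bar>u\<bar> powr q"
proof (cases "\<bar>u\<bar> \<le> \<tau>")
  case False
  then have "\<bar>u\<bar> powr (1 - q) \<le> \<tau> powr (1 - q)"
    using assms by (intro powr_mono2') auto
  then have "\<bar>u\<bar> powr (1 - q) * \<bar>u\<bar> powr q \<le> \<tau> powr (1 - q) * \<bar>u\<bar> powr q"
    by (rule mult_right_mono) simp
  moreover have "\<bar>u\<bar> powr (1 - q) * \<bar>u\<bar> powr q = \<bar>u\<bar>"
    using False assms by (simp flip: powr_add)
  ultimately show ?thesis using assms by linarith
qed (use assms in \<open>simp add: add_increasing2\<close>)

text \<open>
  The elementary substitute for Hoelder's inequality: \<open>\<bar>u\<bar>\<close> is at most \<open>\<tau>\<close> or else, as \<open>py \<ge> 1\<close>, at most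
  \<open>\<tau> powr (1 - py) * \<bar>u\<bar> powr py\<close>. The level \<open>\<tau>\<close> may depend on the distance \<open>d\<close>; as long as it lies between
  powers of \<open>d\<close>, both exponents at \<open>y\<close> can be replaced by those at \<open>x\<close>.
\<close>

lemma potential_kernel_le:
  fixes d m :: real
  assumes \<alpha>: "\<bar>\<alpha>x - \<alpha>y\<bar> * m \<le> La" and p: "\<bar>px - py\<bar> * m \<le> Lp" and py: "1 \<le> py"
    and d: "0 \<le> d" and lnd: "0 < d \<Longrightarrow> \<bar>ln d\<bar> \<le> a * m" and a: "0 \<le> a"
    and \<tau>: "0 < \<tau>" "\<bar>ln \<tau>\<bar> \<le> c * m" and c: "0 \<le> c"
  shows "\<bar>u\<bar> / d powr (N - \<alpha>y)
     \<le> exp (a * La) * (d powr (\<alpha>x - N) * (\<tau> + exp (c * Lp) * \<tau> powr (1 - px) * \<bar>u\<bar> powr py))"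
proof (cases "d = 0")
  case False
  then have d: "0 < d" using d by simp
  have "\<tau> powr (1 - py) \<le> exp (c * Lp) * \<tau> powr (1 - px)"
    using p \<tau> c by (intro powr_change_exponent[of _ _ _ m]) (auto simp: abs_minus_commute)
  then have "\<tau> + \<tau> powr (1 - py) * \<bar>u\<bar> powr py \<le> \<tau> + exp (c * Lp) * \<tau> powr (1 - px) * \<bar>u\<bar> powr py"
    by (intro add_left_mono mult_right_mono) auto
  with abs_le_level_plus_power[OF \<tau>(1) py, of u]
  have u: "\<bar>u\<bar> \<le> \<tau> + exp (c * Lp) * \<tau> powr (1 - px) * \<bar>u\<bar> powr py" by linarith
  have "d powr (\<alpha>y - N) \<le> exp (a * La) * d powr (\<alpha>x - N)"
    using \<alpha> lnd[OF d] d a by (intro powr_change_exponent[of _ _ _ m]) auto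
  then have "d powr (\<alpha>y - N) * \<bar>u\<bar>
      \<le> (exp (a * La) * d powr (\<alpha>x - N)) * (\<tau> + exp (c * Lp) * \<tau> powr (1 - px) * \<bar>u\<bar> powr py)"
    using u by (intro mult_mono) auto
  moreover have "\<bar>u\<bar> / d powr (N - \<alpha>y) = d powr (\<alpha>y - N) * \<bar>u\<bar>"
    using d by (simp add: powr_diff)
  ultimately show ?thesis by (simp add: mult.assoc)
qed simp

section \<open>Hedberg's pointwise bound for the Riesz potential\<close>

lemma nn_integral_cball_lebesgue_on_le:
  fixes \<Omega> :: "(real ^ 'n) set"
  assumes "open \<Omega>" "0 < t"
  shows "(\<integral>\<^sup>+y. indicator (cball x t) y \<partial>lebesgue_on \<Omega>)
           \<le> ennreal (unit_ball_vol (real CARD('n)) * t powr real CARD('n))"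
proof -
  have "(\<integral>\<^sup>+y. indicator (cball x t) y \<partial>lebesgue_on \<Omega>)
      = (\<integral>\<^sup>+y. indicator (cball x t) y * indicator \<Omega> y \<partial>lebesgue)"
    using assms by (subst nn_integral_restrict_space) auto
  also have "\<dots> \<le> (\<integral>\<^sup>+y. indicator (cball x t) y \<partial>lebesgue)"
    by (intro nn_integral_mono) (auto simp: indicator_def)
  also have "\<dots> = emeasure lebesgue (cball x t)" by simp
  also have "\<dots> = ennreal (unit_ball_vol (real CARD('n)) * t powr real CARD('n))"
    using assms by (simp add: emeasure_cball powr_realpow)
  finally show ?thesis .
qed

lemma continuous_on_imp_borel_measurable_lebesgue_on:
  fixes g :: "real ^ 'n \<Rightarrow> real"
  assumes "open \<Omega>" "continuous_on \<Omega> g"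
  shows "g \<in> borel_measurable (lebesgue_on \<Omega>)"
  using assms by (intro continuous_imp_measurable_on_sets_lebesgue) auto

text \<open>
  Hedberg's argument with variable exponents. Write \<open>d\<close> for the distance to \<open>x\<close> and cut at the radius
  \<open>\<rho> = A powr (- 1 / N)\<close>. Inside, the kernel is split at the constant level \<open>A powr (1 / p x)\<close>, and both
  Lebesgue measure and the mass of \<open>\<bar>f\<bar> powr p\<close> grow at a rate that makes the potential over the ball
  of order \<open>A powr (1 / p x) * \<rho> powr \<alpha> x\<close>. Outside, the level \<open>d powr (- N / p x)\<close> turns the second term
  into \<open>\<bar>f\<bar> powr p * d powr - \<delta>\<close> with \<open>\<delta> = N / p x - \<alpha> x\<close>, for which the total mass of \<open>\<bar>f\<bar> powr p\<close>
  suffices; here \<open>\<alpha> p < N\<close> enters, in the form that \<open>\<delta>\<close> is bounded away from 0. The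
  radius \<open>\<rho>\<close> is the one that balances the two parts, and both are then of order
  \<open>A powr (1 / p x - \<alpha> x / N)\<close>. The assumption \<open>A \<ge> 1\<close> gives \<open>\<rho> \<le> 1\<close>, so that on the inner ball the level
  is at most a power of \<open>1 / d\<close>, as the change of exponents requires.
\<close>

lemma Hedberg_bound:
  fixes \<Omega> :: "(real ^ 'n) set" and f p \<alpha> :: "real ^ 'n \<Rightarrow> real"
  defines "N \<equiv> real CARD('n)"
  assumes \<Omega>: "open \<Omega>" "bounded \<Omega>"
    and p: "loc_log_Holder_on \<Omega> p" "\<And>x. x \<in> \<Omega> \<Longrightarrow> 1 \<le> p x" "\<And>x. x \<in> \<Omega> \<Longrightarrow> p x \<le> P"
    and \<alpha>: "loc_log_Holder_on \<Omega> \<alpha>" "0 < a0" "\<And>x. x \<in> \<Omega> \<Longrightarrow> a0 \<le> \<alpha> x"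
    and \<alpha>p: "b < N" "\<And>x. x \<in> \<Omega> \<Longrightarrow> \<alpha> x * p x \<le> b"
    and f[measurable]: "f \<in> borel_measurable (lebesgue_on \<Omega>)" and mod: "modular \<Omega> p f < \<infinity>"
  shows "\<exists>C\<ge>1. \<forall>x\<in>\<Omega>. \<forall>A\<ge>1.
    (\<forall>t>0. (\<integral>\<^sup>+y. ennreal (\<bar>f y\<bar> powr p y) * indicator (cball x t) y \<partial>lebesgue_on \<Omega>) \<le> ennreal (A * t powr N)) \<longrightarrow>
    (\<integral>\<^sup>+y. ennreal (\<bar>f y\<bar> / norm (x - y) powr (N - \<alpha> y)) \<partial>lebesgue_on \<Omega>) \<le> ennreal (C * A powr (1 / p x - \<alpha> x / N))"
proof (cases "\<Omega> = {}")
  case False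
  then obtain z where z: "z \<in> \<Omega>" by blast
  have N: "1 \<le> N" by (simp add: N_def Suc_leI)
  have P: "1 \<le> P" using p(2)[OF z] p(3)[OF z] by linarith
  obtain D0 where D0: "\<And>x y. x \<in> \<Omega> \<Longrightarrow> y \<in> \<Omega> \<Longrightarrow> dist x y \<le> D0"
    using \<Omega>(2) unfolding bounded_two_points by blast
  define D where "D = max 1 D0"
  have D: "1 \<le> D" "\<And>x y. x \<in> \<Omega> \<Longrightarrow> y \<in> \<Omega> \<Longrightarrow> dist x y \<le> D"
    using D0 by (auto simp: D_def intro: max.coboundedI2)
  obtain Lp where Lp: "0 \<le> Lp" "\<And>x y. x \<in> \<Omega> \<Longrightarrow> y \<in> \<Omega> \<Longrightarrow> \<bar>p x - p y\<bar> * log_modulus (dist x y) \<le> Lp"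
    using p(1) unfolding loc_log_Holder_on_def by blast
  obtain La where La: "0 \<le> La" "\<And>x y. x \<in> \<Omega> \<Longrightarrow> y \<in> \<Omega> \<Longrightarrow> \<bar>\<alpha> x - \<alpha> y\<bar> * log_modulus (dist x y) \<le> La"
    using \<alpha>(1) unfolding loc_log_Holder_on_def by blast
  have [measurable]: "p \<in> borel_measurable (lebesgue_on \<Omega>)"
    using \<Omega> p by (intro continuous_on_imp_borel_measurable_lebesgue_on loc_log_Holder_on_imp_continuous_on)
  have dist_meas[measurable]: "dist x \<in> borel_measurable (lebesgue_on \<Omega>)" for x
    using \<Omega> by (intro continuous_on_imp_borel_measurable_lebesgue_on continuous_intros)
  define K where "K = enn2real (modular \<Omega> p f)"
  have K: "modular \<Omega> p f = ennreal K" "0 \<le> K" using mod by (auto simp: K_def)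
  define g where "g y = ennreal (\<bar>f y\<bar> powr p y)" for y
  have g[measurable]: "g \<in> borel_measurable (lebesgue_on \<Omega>)" unfolding g_def by measurable
  have gK: "(\<integral>\<^sup>+y. g y \<partial>lebesgue_on \<Omega>) = ennreal K"
    using K by (simp add: g_def modular_def)
  define a where "a = 1 + ln D"
  have a: "1 \<le> a" using D by (simp add: a_def)
  define d0 where "d0 = (N - b) / P"
  have d0: "0 < d0" using \<alpha>p P by (simp add: d0_def)
  define Ca where "Ca = exp (a * La)"
  define Cp where "Cp = exp (N * a * Lp)"
  define c1 where "c1 = 2 powr N / (1 - 2 powr - a0)"
  define c2 where "c2 = 4 powr N / (1 - 2 powr - d0)"
  define V where "V = unit_ball_vol N"
  have pos: "0 < Ca" "0 < Cp" "0 < c1" "0 < c2" "0 \<le> V"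
    using d0 \<alpha>(2) N powr_less_cancel_iff[of "2::real" "-a0" 0] powr_less_cancel_iff[of "2::real" "-d0" 0]
    by (auto simp: Ca_def Cp_def c1_def c2_def V_def)
  define C where "C = max 1 (Ca * (c1 * V + Cp * c1 + c2 * V + Cp * K))"
  show ?thesis
  proof (intro exI[of _ C] conjI ballI allI impI)
    show "1 \<le> C" by (simp add: C_def)
    fix x A assume x: "x \<in> \<Omega>" and A: "1 \<le> A"
      and growth: "\<forall>t>0. (\<integral>\<^sup>+y. ennreal (\<bar>f y\<bar> powr p y) * indicator (cball x t) y \<partial>lebesgue_on \<Omega>) \<le> ennreal (A * t powr N)"
    define s where "s = \<alpha> x"
    define \<delta> where "\<delta> = N / p x - \<alpha> x"
    define \<rho> where "\<rho> = A powr (- 1 / N)"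
    define e where "e = 1 / p x - \<alpha> x / N"
    have px: "1 \<le> p x" "p x \<le> P" using p x by auto
    have s: "a0 \<le> s" "0 < s" using \<alpha>(2) \<alpha>(3)[OF x] by (auto simp: s_def)
    have "s * 1 \<le> s * p x" using px s by (intro mult_left_mono) auto
    then have sN: "s \<le> N" using \<alpha>p(1) \<alpha>p(2)[OF x] by (simp add: s_def)
    have "d0 \<le> (N - \<alpha> x * p x) / p x"
      unfolding d0_def using px \<alpha>p(1) \<alpha>p(2)[OF x] by (intro frac_le) auto
    also have "\<dots> = \<delta>" using px by (simp add: \<delta>_def field_simps)
    finally have \<delta>: "d0 \<le> \<delta>" .
    have "N / p x \<le> N / 1" using px N by (intro divide_left_mono) auto
    then have \<delta>N: "\<delta> \<le> N" using s by (simp add: \<delta>_def s_def)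
    have \<rho>: "0 < \<rho>" using A by (simp add: \<rho>_def)
    have ge_zero: "0 < A" using A by simp
    have e1: "A powr (1 / p x) * \<rho> powr s = A powr e"
      using ge_zero by (simp add: \<rho>_def e_def s_def powr_powr flip: powr_add)
    have e2: "A powr (1 / p x - 1) * (A * \<rho> powr s) = A powr e"
    proof -
      have "A powr (1 / p x - 1) * A = A powr (1 / p x)"
        using powr_add[of A "1 / p x - 1" 1] ge_zero by simp
      then show ?thesis using e1 by (metis mult.assoc)
    qed
    have e3: "\<rho> powr - \<delta> = A powr e"
      using N px by (simp add: \<rho>_def e_def \<delta>_def powr_powr field_simps)
    let ?near = "\<lambda>y. indicator (cball x \<rho>) y :: ennreal"
    let ?far = "\<lambda>y. indicator (- cball x \<rho>) y :: ennreal"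
    note indicator_cball_borel_measurable[OF dist_meas, measurable]
    \<comment> \<open>Lebesgue measure and the mass of \<open>\<bar>f\<bar> powr p\<close> near \<open>x\<close>, and Lebesgue measure far from \<open>x\<close>; the
      remaining part of the potential is bounded by the total mass of \<open>\<bar>f\<bar> powr p\<close>.\<close>
    define k1 where "k1 y = 1 * ennreal (dist x y powr (s - N)) * ?near y" for y
    define k2 where "k2 y = g y * ennreal (dist x y powr (s - N)) * ?near y" for y
    define k3 where "k3 y = 1 * ennreal (dist x y powr (- \<delta> - N)) * ?far y" for y
    have [measurable]: "k1 \<in> borel_measurable (lebesgue_on \<Omega>)" "k2 \<in> borel_measurable (lebesgue_on \<Omega>)"
      "k3 \<in> borel_measurable (lebesgue_on \<Omega>)" unfolding k1_def k2_def k3_def by measurable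
    have i1: "(\<integral>\<^sup>+y. k1 y \<partial>lebesgue_on \<Omega>) \<le> ennreal (c1 * V * \<rho> powr s)"
      unfolding k1_def c1_def using pos \<rho> s sN \<alpha>(2) \<Omega>
      by (intro nn_integral_potential_near) (auto simp: V_def N_def intro!: nn_integral_cball_lebesgue_on_le)
    have i2: "(\<integral>\<^sup>+y. k2 y \<partial>lebesgue_on \<Omega>) \<le> ennreal (c1 * A * \<rho> powr s)"
      unfolding k2_def c1_def using pos \<rho> s sN \<alpha>(2) A growth
      by (intro nn_integral_potential_near) (auto simp: g_def)
    have i3: "(\<integral>\<^sup>+y. k3 y \<partial>lebesgue_on \<Omega>) \<le> ennreal (c2 * V * \<rho> powr - \<delta>)"
      unfolding k3_def c2_def using pos \<rho> \<delta> \<delta>N d0 \<Omega>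
      by (intro nn_integral_potential_far) (auto simp: V_def N_def intro!: nn_integral_cball_lebesgue_on_le)
    have dom: "ennreal (\<bar>f y\<bar> / norm (x - y) powr (N - \<alpha> y))
       \<le> ennreal Ca * (ennreal (A powr (1 / p x)) * k1 y + ennreal (Cp * A powr (1 / p x - 1)) * k2 y
            + k3 y + ennreal (Cp * \<rho> powr - \<delta>) * g y)" if y: "y \<in> \<Omega>" for y
    proof -
      define d where "d = dist x y"
      define m where "m = log_modulus d"
      have d: "0 \<le> d" "norm (x - y) = d" by (auto simp: d_def dist_norm)
      have m: "1 \<le> m" unfolding m_def using d by (intro log_modulus_ge_1)
      have lnd: "\<bar>ln d\<bar> \<le> a * m" if "0 < d"
        using that D(2)[OF x y] D(1) unfolding m_def a_def d_def by (intro abs_ln_le_log_modulus) auto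
      have gy: "g y = ennreal (\<bar>f y\<bar> powr p y)" by (simp add: g_def)
      have kernel: "\<bar>f y\<bar> / norm (x - y) powr (N - \<alpha> y)
          \<le> Ca * (d powr (s - N) * (\<tau> + Cp * \<tau> powr (1 - p x) * \<bar>f y\<bar> powr p y))"
        if \<tau>: "0 < \<tau>" "\<bar>ln \<tau>\<bar> \<le> N * a * m" for \<tau>
        unfolding Ca_def Cp_def d(2) s_def
        using La(2)[OF x y] Lp(2)[OF x y] p(2)[OF y] d lnd a \<tau> N
        by (intro potential_kernel_le[where m = m]) (auto simp: m_def d_def)
      show ?thesis
      proof (cases "d = 0")
        case True
        then show ?thesis using d by simp
      next
        case False
        with d have dp: "0 < d" by simp
        show ?thesis
        proof (cases "d \<le> \<rho>")
          case near: True
          define \<tau> where "\<tau> = A powr (1 / p x)"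
          \<comment> \<open>Since \<open>d \<le> \<rho>\<close> means \<open>A \<le> d powr - N\<close>, the level is admissible for a change of exponent.\<close>
          have "ln A = - (N * ln \<rho>)" using N A by (simp add: \<rho>_def)
          also have "\<dots> \<le> N * - ln d" using near dp N by simp
          also have "\<dots> \<le> N * (a * m)" using lnd[OF dp] N by (intro mult_left_mono) auto
          finally have lnA: "ln A \<le> N * a * m" by (simp add: mult.assoc)
          have "0 \<le> ln \<tau>" "ln \<tau> \<le> ln A"
            using A px by (auto simp: \<tau>_def field_simps mult_le_cancel_left1)
          then have "\<bar>ln \<tau>\<bar> \<le> N * a * m" using lnA by linarith
          moreover have "0 < \<tau>" using A by (simp add: \<tau>_def)
          ultimately have "\<bar>f y\<bar> / norm (x - y) powr (N - \<alpha> y)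
              \<le> Ca * (d powr (s - N) * (\<tau> + Cp * \<tau> powr (1 - p x) * \<bar>f y\<bar> powr p y))"
            by (intro kernel)
          also have "\<tau> powr (1 - p x) = A powr (1 / p x - 1)"
            using px by (simp add: \<tau>_def powr_powr diff_divide_distrib)
          also have "d powr (s - N) * (\<tau> + Cp * A powr (1 / p x - 1) * \<bar>f y\<bar> powr p y)
              = \<tau> * d powr (s - N) + Cp * A powr (1 / p x - 1) * (\<bar>f y\<bar> powr p y * d powr (s - N))"
            by (simp add: algebra_simps)
          finally have "ennreal (\<bar>f y\<bar> / norm (x - y) powr (N - \<alpha> y))
              \<le> ennreal (Ca * (\<tau> * d powr (s - N) + Cp * A powr (1 / p x - 1) * (\<bar>f y\<bar> powr p y * d powr (s - N))))"
            by (rule ennreal_leI)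
          also have "\<dots> = ennreal Ca * (ennreal \<tau> * k1 y + ennreal (Cp * A powr (1 / p x - 1)) * k2 y)"
            using near pos unfolding k1_def k2_def gy d_def
            by (simp add: ennreal_mult' ennreal_mult'' mult.assoc \<tau>_def)
          also have "\<dots> \<le> ennreal Ca * (ennreal \<tau> * k1 y + ennreal (Cp * A powr (1 / p x - 1)) * k2 y
            + k3 y + ennreal (Cp * \<rho> powr - \<delta>) * g y)"
            by (intro mult_left_mono) (auto simp: add.assoc intro: add_increasing2)
          finally show ?thesis by (simp add: \<tau>_def)
        next
          case far: False
          define \<tau> where "\<tau> = d powr (- N / p x)"
          have "\<bar>ln \<tau>\<bar> = N / p x * \<bar>ln d\<bar>"
            using dp N px by (simp add: \<tau>_def abs_mult)
          also have "\<dots> \<le> N * \<bar>ln d\<bar>"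
            using \<open>N / p x \<le> N / 1\<close> by (intro mult_right_mono) auto
          also have "\<dots> \<le> N * (a * m)" using lnd[OF dp] N by (intro mult_left_mono) auto
          finally have "\<bar>ln \<tau>\<bar> \<le> N * a * m" by (simp add: mult.assoc)
          moreover have "0 < \<tau>" using dp by (simp add: \<tau>_def)
          ultimately have "\<bar>f y\<bar> / norm (x - y) powr (N - \<alpha> y)
              \<le> Ca * (d powr (s - N) * (\<tau> + Cp * \<tau> powr (1 - p x) * \<bar>f y\<bar> powr p y))"
            by (intro kernel)
          also have "d powr (s - N) * (\<tau> + Cp * \<tau> powr (1 - p x) * \<bar>f y\<bar> powr p y)
             = d powr (- \<delta> - N) + Cp * d powr - \<delta> * \<bar>f y\<bar> powr p y"
          proof -
            have "d powr (s - N) * \<tau> = d powr (- \<delta> - N)"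
              by (simp add: \<tau>_def s_def \<delta>_def algebra_simps flip: powr_add)
            moreover have "d powr (s - N) * \<tau> powr (1 - p x) = d powr - \<delta>"
            proof -
              have "(s - N) + - N / p x * (1 - p x) = - \<delta>"
                using px by (simp add: s_def \<delta>_def field_simps)
              then show ?thesis by (metis \<tau>_def powr_add powr_powr)
            qed
            ultimately show ?thesis by (metis distrib_left mult.assoc mult.left_commute)
          qed
          also have "\<dots> \<le> d powr (- \<delta> - N) + Cp * \<rho> powr - \<delta> * \<bar>f y\<bar> powr p y"
            using far \<rho> \<delta> d0 pos by (intro add_left_mono mult_right_mono mult_left_mono powr_mono2') auto
          finally have "ennreal (\<bar>f y\<bar> / norm (x - y) powr (N - \<alpha> y))
              \<le> ennreal (Ca * (d powr (- \<delta> - N) + Cp * \<rho> powr - \<delta> * \<bar>f y\<bar> powr p y))"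
            using pos by (intro ennreal_leI) (auto intro: mult_left_mono)
          also have "\<dots> = ennreal Ca * (k3 y + ennreal (Cp * \<rho> powr - \<delta>) * g y)"
            using far pos unfolding k3_def gy d_def
            by (simp add: ennreal_mult' ennreal_mult'' mult.assoc)
          also have "\<dots> \<le> ennreal Ca * (ennreal (A powr (1 / p x)) * k1 y + ennreal (Cp * A powr (1 / p x - 1)) * k2 y
            + k3 y + ennreal (Cp * \<rho> powr - \<delta>) * g y)"
            by (intro mult_left_mono add_right_mono) (auto intro: add_increasing)
          finally show ?thesis .
        qed
      qed
    qed
    have "(\<integral>\<^sup>+y. ennreal (\<bar>f y\<bar> / norm (x - y) powr (N - \<alpha> y)) \<partial>lebesgue_on \<Omega>)
      \<le> (\<integral>\<^sup>+y. ennreal Ca * (ennreal (A powr (1 / p x)) * k1 y + ennreal (Cp * A powr (1 / p x - 1)) * k2 y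
            + k3 y + ennreal (Cp * \<rho> powr - \<delta>) * g y) \<partial>lebesgue_on \<Omega>)"
      using dom by (intro nn_integral_mono) auto
    also have "\<dots> = ennreal Ca * (ennreal (A powr (1 / p x)) * (\<integral>\<^sup>+y. k1 y \<partial>lebesgue_on \<Omega>)
          + ennreal (Cp * A powr (1 / p x - 1)) * (\<integral>\<^sup>+y. k2 y \<partial>lebesgue_on \<Omega>)
          + (\<integral>\<^sup>+y. k3 y \<partial>lebesgue_on \<Omega>) + ennreal (Cp * \<rho> powr - \<delta>) * (\<integral>\<^sup>+y. g y \<partial>lebesgue_on \<Omega>))"
      by (simp add: nn_integral_cmult nn_integral_add)
    also have "\<dots> \<le> ennreal Ca * (ennreal (A powr (1 / p x)) * ennreal (c1 * V * \<rho> powr s)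
          + ennreal (Cp * A powr (1 / p x - 1)) * ennreal (c1 * A * \<rho> powr s)
          + ennreal (c2 * V * \<rho> powr - \<delta>) + ennreal (Cp * \<rho> powr - \<delta>) * ennreal K)"
      unfolding gK by (intro mult_left_mono add_mono i1 i2 i3 order_refl) auto
    also have "\<dots> = ennreal (Ca * (A powr (1 / p x) * (c1 * V * \<rho> powr s)
          + Cp * A powr (1 / p x - 1) * (c1 * A * \<rho> powr s)
          + c2 * V * \<rho> powr - \<delta> + Cp * \<rho> powr - \<delta> * K))"
      using pos A K(2) by (simp add: ennreal_mult' ennreal_mult'')
    also have "Ca * (A powr (1 / p x) * (c1 * V * \<rho> powr s)
          + Cp * A powr (1 / p x - 1) * (c1 * A * \<rho> powr s)
          + c2 * V * \<rho> powr - \<delta> + Cp * \<rho> powr - \<delta> * K)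
        = Ca * (c1 * V * (A powr (1 / p x) * \<rho> powr s)
          + Cp * c1 * (A powr (1 / p x - 1) * (A * \<rho> powr s))
          + c2 * V * \<rho> powr - \<delta> + Cp * K * \<rho> powr - \<delta>)"
      by (simp add: mult_ac)
    also have "\<dots> = Ca * (c1 * V + Cp * c1 + c2 * V + Cp * K) * A powr e"
      unfolding e1 e2 e3 by (simp add: algebra_simps)
    also have "ennreal \<dots> \<le> ennreal (C * A powr e)"
      by (intro ennreal_leI mult_right_mono) (auto simp: C_def)
    finally show "(\<integral>\<^sup>+y. ennreal (\<bar>f y\<bar> / norm (x - y) powr (N - \<alpha> y)) \<partial>lebesgue_on \<Omega>)
      \<le> ennreal (C * A powr (1 / p x - \<alpha> x / N))" by (simp add: e_def)
  qed
qed auto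

section \<open>A weak type inequality with a variable exponent\<close>

lemma nn_integral_count_space_disjoint_le_1:
  assumes "pairwise (\<lambda>i j. disjnt (B i) (B j)) I"
  shows "(\<integral>\<^sup>+i. indicator (B i) y \<partial>count_space I) \<le> (1 :: ennreal)"
proof (cases "\<exists>i\<in>I. y \<in> B i")
  case True
  then obtain i where i: "i \<in> I" "y \<in> B i" by blast
  have "j = i" if "j \<in> I" "y \<in> B j" for j
    using assms i that unfolding pairwise_def disjnt_def by blast
  then have "(\<integral>\<^sup>+j. indicator (B j) y \<partial>count_space I) \<le> (\<integral>\<^sup>+j. indicator {i} j \<partial>count_space I)"
    by (intro nn_integral_mono) (auto simp: indicator_def)
  also have "\<dots> = 1" using i by simp
  finally show ?thesis .
next
  case False
  then have "(\<integral>\<^sup>+i. indicator (B i) y \<partial>count_space I) = (\<integral>\<^sup>+i. 0 \<partial>count_space I)"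
    by (intro nn_integral_cong) (auto simp: indicator_def)
  then show ?thesis by simp
qed

text \<open>
  A ball of radius \<open>t\<close> around \<open>x\<close> that carries mass at least \<open>c * l powr s x * t powr N\<close> forces \<open>l\<close> to be
  at most a power of \<open>1 / t\<close>, since the total mass \<open>K\<close> is finite. So \<open>l\<close> may change its exponent within
  the fivefold ball.
\<close>

lemma powr_le_on_large_mass_ball:
  fixes \<Omega> :: "(real ^ 'n) set" and s :: "real ^ 'n \<Rightarrow> real"
  assumes s: "loc_log_Holder_on \<Omega> s" "0 < s0" "\<And>x. x \<in> \<Omega> \<Longrightarrow> s0 \<le> s x"
    and N: "0 \<le> N" and c: "0 < c" and K: "0 < K"
  shows "\<exists>C\<ge>0. \<forall>x\<in>\<Omega>. \<forall>y\<in>\<Omega>. \<forall>t>0. \<forall>l\<ge>1. c * l powr s x * t powr N \<le> K \<longrightarrow>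
           dist x y \<le> 5 * t \<longrightarrow> l powr s y \<le> C * l powr s x"
proof -
  obtain L where L: "0 \<le> L" "\<And>x y. x \<in> \<Omega> \<Longrightarrow> y \<in> \<Omega> \<Longrightarrow> \<bar>s x - s y\<bar> * log_modulus (dist x y) \<le> L"
    using s(1) unfolding loc_log_Holder_on_def by blast
  define a where "a = (\<bar>ln (K / c)\<bar> + N * (ln 5 + 1)) / s0"
  have a: "0 \<le> a" unfolding a_def using s N by (intro divide_nonneg_pos add_nonneg_nonneg mult_nonneg_nonneg) auto
  show ?thesis
  proof (intro exI[of _ "exp (a * L)"] conjI ballI allI impI)
    fix x y and t l :: real
    assume x: "x \<in> \<Omega>" and y: "y \<in> \<Omega>" and t: "0 < t" and l: "1 \<le> l"
      and mass: "c * l powr s x * t powr N \<le> K" and d5: "dist x y \<le> 5 * t"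
    define m where "m = log_modulus (dist x y)"
    have m: "1 \<le> m" unfolding m_def by (intro log_modulus_ge_1) simp
    show "l powr s y \<le> exp (a * L) * l powr s x"
    proof (cases "x = y")
      case True
      have "1 \<le> exp (a * L)" using a L by simp
      then show ?thesis using True mult_right_mono[of 1 "exp (a * L)" "l powr s x"] by simp
    next
      case False
      then have d: "0 < dist x y" by simp
      have l0: "0 \<le> ln l" using l by simp
      have "ln (c * l powr s x * t powr N) \<le> ln K" using mass c l t K by (subst ln_le_cancel_iff) auto
      then have "ln c + s x * ln l + N * ln t \<le> ln K"
        using c l t by (simp add: ln_mult)
      then have 1: "s x * ln l \<le> ln (K / c) - N * ln t" using K c by (simp add: ln_div)
      have "ln (dist x y) \<le> ln (5 * t)" using d d5 t by (subst ln_le_cancel_iff) auto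
      then have "- ln t \<le> ln 5 + ln (1 / dist x y)" using t d by (simp add: ln_mult ln_div)
      also have "ln (1 / dist x y) \<le> m" unfolding m_def log_modulus_def
        using d by (subst ln_le_cancel_iff) (auto intro: add_pos_pos)
      finally have "N * - ln t \<le> N * (ln 5 + m)" using N by (intro mult_left_mono) auto
      moreover have "s0 * ln l \<le> s x * ln l" using s(3)[OF x] l0 by (rule mult_right_mono)
      ultimately have "s0 * ln l \<le> \<bar>ln (K / c)\<bar> + N * (ln 5 + m)" using 1 by linarith
      also have "\<dots> \<le> \<bar>ln (K / c)\<bar> * m + N * (ln 5 * m + m)"
        using m N by (intro add_mono mult_left_mono) (auto simp: mult_le_cancel_left1)
      also have "\<dots> = s0 * (a * m)" using s(2) by (simp add: a_def field_simps)
      finally have "\<bar>ln l\<bar> \<le> a * m" using s(2) l0 by simp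
      then show ?thesis
        using L(2)[OF x y] l a by (intro powr_change_exponent[where m = m]) (auto simp: m_def)
    qed
  qed simp
qed

text \<open>
  The weak type inequality for the centred maximal function, with the level \<open>l powr s x\<close> varying from
  point to point. The proof is the classical one: by Vitali's covering lemma, disjoint balls of large
  mass have fivefold enlargements that cover \<open>E\<close>. The integrand \<open>l powr s\<close> is not constant on an enlarged
  ball, but by the preceding lemma it is at most a constant times its value at the centre.
  The masses of disjoint balls add up to at most the total mass.
\<close>

lemma variable_weak_type_estimate:
  fixes \<Omega> :: "(real ^ 'n) set" and s :: "real ^ 'n \<Rightarrow> real" and w :: "real ^ 'n \<Rightarrow> ennreal"
  defines "N \<equiv> real CARD('n)"
  assumes \<Omega>: "open \<Omega>"
    and s: "loc_log_Holder_on \<Omega> s" "0 < s0" "\<And>x. x \<in> \<Omega> \<Longrightarrow> s0 \<le> s x"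
    and c: "0 < c"
    and w[measurable]: "w \<in> borel_measurable (lebesgue_on \<Omega>)" and wfin: "(\<integral>\<^sup>+y. w y \<partial>lebesgue_on \<Omega>) < \<infinity>"
  shows "\<exists>C. \<forall>l\<ge>1. \<forall>E\<subseteq>\<Omega>.
    (\<forall>x\<in>E. \<exists>t>0. ennreal (c * l powr s x * t powr N) \<le> (\<integral>\<^sup>+y. w y * indicator (cball x t) y \<partial>lebesgue_on \<Omega>)) \<longrightarrow>
    (\<integral>\<^sup>+y. ennreal (l powr s y) * indicator E y \<partial>lebesgue_on \<Omega>) \<le> ennreal C"
proof -
  have N: "1 \<le> N" by (simp add: N_def Suc_leI)
  define K where "K = enn2real (\<integral>\<^sup>+y. w y \<partial>lebesgue_on \<Omega>) + 1"
  have K: "0 < K" "(\<integral>\<^sup>+y. w y \<partial>lebesgue_on \<Omega>) \<le> ennreal K"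
    using wfin by (auto simp: K_def ennreal_enn2real_if add_nonneg_pos intro!: ennreal_leI) 
  obtain C0 where C0: "0 \<le> C0" "\<And>x y t l. x \<in> \<Omega> \<Longrightarrow> y \<in> \<Omega> \<Longrightarrow> 0 < t \<Longrightarrow> 1 \<le> l \<Longrightarrow>
      c * l powr s x * t powr N \<le> K \<Longrightarrow> dist x y \<le> 5 * t \<Longrightarrow> l powr s y \<le> C0 * l powr s x"
    using powr_le_on_large_mass_ball[OF s _ c K(1), of N] N by auto
  have [measurable]: "s \<in> borel_measurable (lebesgue_on \<Omega>)"
    using \<Omega> s by (intro continuous_on_imp_borel_measurable_lebesgue_on loc_log_Holder_on_imp_continuous_on)
  have "dist x \<in> borel_measurable (lebesgue_on \<Omega>)" for x
    using \<Omega> by (intro continuous_on_imp_borel_measurable_lebesgue_on continuous_intros)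
  note indicator_cball_borel_measurable[OF this, measurable]
  define V where "V = unit_ball_vol N"
  have V: "0 \<le> V" using N by (simp add: V_def)
  define C1 where "C1 = C0 * V * 5 powr N / c"
  have C1: "0 \<le> C1" using C0 V c by (simp add: C1_def)
  show ?thesis
  proof (intro exI[of _ "C1 * K"] allI impI)
    fix l :: real and E assume l: "1 \<le> l" and E: "E \<subseteq> \<Omega>"
      and big: "\<forall>x\<in>E. \<exists>t>0. ennreal (c * l powr s x * t powr N) \<le> (\<integral>\<^sup>+y. w y * indicator (cball x t) y \<partial>lebesgue_on \<Omega>)"
    from big obtain t where t: "\<And>x. x \<in> E \<Longrightarrow> 0 < t x"
      "\<And>x. x \<in> E \<Longrightarrow> ennreal (c * l powr s x * t x powr N) \<le> (\<integral>\<^sup>+y. w y * indicator (cball x (t x)) y \<partial>lebesgue_on \<Omega>)"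
      by metis
    have mass: "c * l powr s x * t x powr N \<le> K" if "x \<in> E" for x
    proof -
      have "ennreal (c * l powr s x * t x powr N) \<le> (\<integral>\<^sup>+y. w y * indicator (cball x (t x)) y \<partial>lebesgue_on \<Omega>)"
        using t that by blast
      also have "\<dots> \<le> (\<integral>\<^sup>+y. w y \<partial>lebesgue_on \<Omega>)" by (intro nn_integral_mono) (auto simp: indicator_def)
      also have "\<dots> \<le> ennreal K" by (rule K)
      finally show ?thesis using K by (simp add: ennreal_le_iff)
    qed
    have radius: "t x \<le> (K / c) powr (1 / N)" if x: "x \<in> E" for x
    proof -
      have "1 \<le> l powr s x" using l s(2) s(3)[of x] x E by (intro ge_one_powr_ge_zero) auto
      then have "c * 1 * t x powr N \<le> c * l powr s x * t x powr N"
        using c by (intro mult_right_mono mult_left_mono) auto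
      then have "c * 1 * t x powr N \<le> K" using mass[OF x] by (rule order_trans)
      then have "t x powr N \<le> K / c" using c by (simp add: field_simps)
      then have "(t x powr N) powr (1 / N) \<le> (K / c) powr (1 / N)" using N by (intro powr_mono2) auto
      then show ?thesis using t(1)[OF x] N by (simp add: powr_powr)
    qed
    obtain I where I: "countable I" "I \<subseteq> E"
      "pairwise (\<lambda>i j. disjnt (cball i (t i)) (cball j (t j))) I"
      "E \<subseteq> (\<Union>i\<in>I. cball i (5 * t i))"
    proof (rule Vitali_covering_lemma_cballs[where S = E and K = E and a = "\<lambda>x. x" and r = t and B = "(K / c) powr (1 / N)"])
      show "E \<subseteq> (\<Union>i\<in>E. cball i (t i))" using t(1) by (force intro: less_imp_le)
    qed (use t radius in auto)
    have ball: "(\<integral>\<^sup>+y. ennreal (l powr s y) * indicator (cball i (5 * t i)) y \<partial>lebesgue_on \<Omega>)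
        \<le> ennreal C1 * (\<integral>\<^sup>+y. w y * indicator (cball i (t i)) y \<partial>lebesgue_on \<Omega>)" if "i \<in> I" for i
    proof -
      have i: "i \<in> E" "i \<in> \<Omega>" "0 < t i" using that I E t by auto
      have "(\<integral>\<^sup>+y. ennreal (l powr s y) * indicator (cball i (5 * t i)) y \<partial>lebesgue_on \<Omega>)
          \<le> (\<integral>\<^sup>+y. ennreal (C0 * l powr s i) * indicator (cball i (5 * t i)) y \<partial>lebesgue_on \<Omega>)"
        using C0(2)[OF i(2) _ i(3) l mass[OF i(1)]]
        by (intro nn_integral_mono) (auto simp: indicator_def intro!: ennreal_leI)
      also have "\<dots> = ennreal (C0 * l powr s i) * (\<integral>\<^sup>+y. indicator (cball i (5 * t i)) y \<partial>lebesgue_on \<Omega>)"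
        by (rule nn_integral_cmult) simp
      also have "\<dots> \<le> ennreal (C0 * l powr s i) * ennreal (V * (5 * t i) powr N)"
        unfolding V_def N_def using i \<Omega> by (intro mult_left_mono nn_integral_cball_lebesgue_on_le) auto
      also have "\<dots> = ennreal (C1 * (c * l powr s i * t i powr N))"
        using c C0 V i by (subst ennreal_mult'[symmetric]) (auto simp: C1_def powr_mult)
      also have "\<dots> = ennreal C1 * ennreal (c * l powr s i * t i powr N)" using C1 by (simp add: ennreal_mult')
      also have "\<dots> \<le> ennreal C1 * (\<integral>\<^sup>+y. w y * indicator (cball i (t i)) y \<partial>lebesgue_on \<Omega>)"
        using t(2)[OF i(1)] by (intro mult_left_mono) auto
      finally show ?thesis .
    qed
    have "(\<integral>\<^sup>+y. ennreal (l powr s y) * indicator E y \<partial>lebesgue_on \<Omega>)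
       \<le> (\<integral>\<^sup>+y. (\<integral>\<^sup>+i. ennreal (l powr s y) * indicator (cball i (5 * t i)) y \<partial>count_space I) \<partial>lebesgue_on \<Omega>)"
    proof (rule nn_integral_mono)
      fix y
      show "ennreal (l powr s y) * indicator E y
          \<le> (\<integral>\<^sup>+i. ennreal (l powr s y) * indicator (cball i (5 * t i)) y \<partial>count_space I)"
      proof (cases "y \<in> E")
        case True
        then obtain i where i: "i \<in> I" "y \<in> cball i (5 * t i)" using I(4) by blast
        have "ennreal (l powr s y) * indicator (cball i (5 * t i)) y
            \<le> (\<integral>\<^sup>+i. ennreal (l powr s y) * indicator (cball i (5 * t i)) y \<partial>count_space I)"
          using i(1) by (rule nn_integral_ge_point)
        then show ?thesis using i True by simp
      qed simp
    qed
    also have "\<dots> = (\<integral>\<^sup>+i. (\<integral>\<^sup>+y. ennreal (l powr s y) * indicator (cball i (5 * t i)) y \<partial>lebesgue_on \<Omega>) \<partial>count_space I)"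
      using I(1) by (intro nn_integral_count_space_nn_integral) auto
    also have "\<dots> \<le> (\<integral>\<^sup>+i. ennreal C1 * (\<integral>\<^sup>+y. w y * indicator (cball i (t i)) y \<partial>lebesgue_on \<Omega>) \<partial>count_space I)"
      using ball by (intro nn_integral_mono) auto
    also have "\<dots> = ennreal C1 * (\<integral>\<^sup>+i. (\<integral>\<^sup>+y. w y * indicator (cball i (t i)) y \<partial>lebesgue_on \<Omega>) \<partial>count_space I)"
      by (rule nn_integral_cmult) simp
    also have "(\<integral>\<^sup>+i. (\<integral>\<^sup>+y. w y * indicator (cball i (t i)) y \<partial>lebesgue_on \<Omega>) \<partial>count_space I)
       = (\<integral>\<^sup>+y. (\<integral>\<^sup>+i. w y * indicator (cball i (t i)) y \<partial>count_space I) \<partial>lebesgue_on \<Omega>)"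
      using I(1) by (intro nn_integral_count_space_nn_integral[symmetric]) auto
    also have "\<dots> = (\<integral>\<^sup>+y. w y * (\<integral>\<^sup>+i. indicator (cball i (t i)) y \<partial>count_space I) \<partial>lebesgue_on \<Omega>)"
      by (intro nn_integral_cong nn_integral_cmult) simp
    also have "\<dots> \<le> (\<integral>\<^sup>+y. w y * 1 \<partial>lebesgue_on \<Omega>)"
      using I(3) by (intro nn_integral_mono mult_left_mono nn_integral_count_space_disjoint_le_1) auto
    also have "\<dots> \<le> ennreal K" using K by simp
    also have "ennreal C1 * ennreal K = ennreal (C1 * K)" using C1 K by (simp add: ennreal_mult')
    finally show "(\<integral>\<^sup>+y. ennreal (l powr s y) * indicator E y \<partial>lebesgue_on \<Omega>) \<le> ennreal (C1 * K)"
      by (simp add: mult_left_mono)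
  qed
qed

section \<open>Measurability of the Riesz potential\<close>

lemma lebesgue_on_borel_version:
  fixes \<Omega> :: "(real ^ 'n) set" and g :: "real ^ 'n \<Rightarrow> real"
  assumes "open \<Omega>" "g \<in> borel_measurable (lebesgue_on \<Omega>)"
  obtains g' where "g' \<in> borel_measurable borel" "AE y in lborel. indicator \<Omega> y * g y = g' y"
proof -
  have "(\<lambda>y. indicator \<Omega> y *\<^sub>R g y) \<in> borel_measurable lebesgue"
    using assms by (subst (asm) borel_measurable_restrict_space_iff) auto
  then have "(\<lambda>y. indicator \<Omega> y * g y) \<in> borel_measurable (completion lborel)" by simp
  from completion_ex_borel_measurable_real[OF this] show ?thesis using that by auto
qed

text \<open>
  Measurability in \<open>x\<close> of an integral over \<open>y\<close> comes from Tonelli's theorem, which needs a kernel that is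
  measurable for the product of Borel sigma-algebras. Replacing \<open>f\<close> and \<open>\<alpha>\<close> by Borel functions that agree
  with them almost everywhere on \<open>\<Omega>\<close> does not change the integral for any \<open>x\<close>.
\<close>

lemma Riesz_potential_borel_measurable:
  fixes \<Omega> :: "(real ^ 'n) set" and f \<alpha> :: "real ^ 'n \<Rightarrow> real"
  assumes \<Omega>: "open \<Omega>" and f: "f \<in> borel_measurable (lebesgue_on \<Omega>)"
    and \<alpha>: "\<alpha> \<in> borel_measurable (lebesgue_on \<Omega>)"
  shows "Riesz_potential \<Omega> \<alpha> f \<in> borel_measurable (lebesgue_on \<Omega>)"
proof -
  obtain f' where f'[measurable]: "f' \<in> borel_measurable borel"
    and f'_eq: "AE y in lborel. indicator \<Omega> y * f y = f' y"
    using lebesgue_on_borel_version[OF \<Omega> f] .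
  obtain \<alpha>' where \<alpha>'[measurable]: "\<alpha>' \<in> borel_measurable borel"
    and \<alpha>'_eq: "AE y in lborel. indicator \<Omega> y * \<alpha> y = \<alpha>' y"
    using lebesgue_on_borel_version[OF \<Omega> \<alpha>] .
  let ?h = "\<lambda>x y. ennreal (\<bar>f' y\<bar> / norm (x - y) powr (real CARD('n) - \<alpha>' y))"
  have "(\<integral>\<^sup>+y. ennreal (\<bar>f y\<bar> / norm (x - y) powr (real CARD('n) - \<alpha> y)) \<partial>lebesgue_on \<Omega>)
      = (\<integral>\<^sup>+y. ?h x y \<partial>lborel)" for x
  proof -
    have "(\<integral>\<^sup>+y. ennreal (\<bar>f y\<bar> / norm (x - y) powr (real CARD('n) - \<alpha> y)) \<partial>lebesgue_on \<Omega>)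
      = (\<integral>\<^sup>+y. ennreal (\<bar>f y\<bar> / norm (x - y) powr (real CARD('n) - \<alpha> y)) * indicator \<Omega> y \<partial>lborel)"
      using \<Omega> by (subst nn_integral_restrict_space) (auto simp: nn_integral_completion)
    also have "\<dots> = (\<integral>\<^sup>+y. ?h x y \<partial>lborel)"
    proof (rule nn_integral_cong_AE)
      show "AE y in lborel. ennreal (\<bar>f y\<bar> / norm (x - y) powr (real CARD('n) - \<alpha> y)) * indicator \<Omega> y = ?h x y"
        using f'_eq \<alpha>'_eq
      proof eventually_elim
        case (elim y)
        then show ?case by (cases "y \<in> \<Omega>") auto
      qed
    qed
    finally show ?thesis .
  qed
  then have eq: "Riesz_potential \<Omega> \<alpha> f = (\<lambda>x. enn2ereal (\<integral>\<^sup>+y. ?h x y \<partial>lborel))"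
    by (simp add: Riesz_potential_def fun_eq_iff)
  have "(\<lambda>x. enn2ereal (\<integral>\<^sup>+y. ?h x y \<partial>lborel)) \<in> borel_measurable borel"
    by measurable
  then have "(\<lambda>x. enn2ereal (\<integral>\<^sup>+y. ?h x y \<partial>lborel)) \<in> borel_measurable lebesgue"
    by (intro measurable_completion) simp
  then show ?thesis unfolding eq by (rule measurable_restrict_space1)
qed

lemma ereal_powr_borel_measurable:
  assumes [measurable]: "R \<in> borel_measurable M" "q \<in> borel_measurable M"
  shows "(\<lambda>x. ereal_powr (R x) (q x)) \<in> borel_measurable M"
  unfolding ereal_powr_def by measurable

section \<open>Membership in the weak space\<close>

text \<open>
  A uniform bound for the modular of \<open>l\<close> times the indicator of the superlevel set at \<open>l\<close> is enough:
  dividing by \<open>k = max 1 C powr (1 / s0)\<close> lowers this modular by the factor \<open>max 1 C\<close> at least, because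
  \<open>k \<ge> 1\<close> and \<open>s \<ge> s0\<close>, so the Luxemburg norm of the indicator is at most \<open>k / l\<close>.
\<close>

lemma weak_var_LspaceI:
  fixes \<Omega> :: "(real ^ 'n) set" and s :: "real ^ 'n \<Rightarrow> real"
  assumes \<Omega>: "open \<Omega>" and F[measurable]: "F \<in> borel_measurable (lebesgue_on \<Omega>)"
    and s[measurable]: "s \<in> borel_measurable (lebesgue_on \<Omega>)"
    and s0: "0 < s0" "\<And>x. x \<in> \<Omega> \<Longrightarrow> s0 \<le> s x"
    and bound: "\<And>l. 0 < l \<Longrightarrow>
      (\<integral>\<^sup>+y. ennreal (l powr s y) * indicator {x \<in> \<Omega>. ereal l < \<bar>F x\<bar>} y \<partial>lebesgue_on \<Omega>) \<le> ennreal C"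
  shows "F \<in> weak_var_Lspace \<Omega> s"
proof -
  define k where "k = max 1 C powr (1 / s0)"
  have k: "1 \<le> k" using s0 by (simp add: k_def ge_one_powr_ge_zero)
  have ks0: "k powr s0 = max 1 C" using s0 by (simp add: k_def powr_powr)
  have "ennreal l * Luxemburg_norm \<Omega> s (indicator {x \<in> \<Omega>. ereal l < \<bar>F x\<bar>}) \<le> ennreal k"
    if l: "0 < l" for l
  proof -
    define E where "E = {x \<in> \<Omega>. ereal l < \<bar>F x\<bar>}"
    have "{x \<in> space (lebesgue_on \<Omega>). ereal l < \<bar>F x\<bar>} \<in> sets (lebesgue_on \<Omega>)" by measurable
    then have [measurable]: "E \<in> sets (lebesgue_on \<Omega>)" by (simp add: E_def)
    have "modular \<Omega> s (\<lambda>x. indicator E x / (k / l))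
        \<le> (\<integral>\<^sup>+y. ennreal (1 / max 1 C) * (ennreal (l powr s y) * indicator E y) \<partial>lebesgue_on \<Omega>)"
      unfolding modular_def
    proof (rule nn_integral_mono)
      fix y assume "y \<in> space (lebesgue_on \<Omega>)"
      then have y: "y \<in> \<Omega>" by simp
      show "ennreal (\<bar>indicator E y / (k / l)\<bar> powr s y)
          \<le> ennreal (1 / max 1 C) * (ennreal (l powr s y) * indicator E y)"
      proof (cases "y \<in> E")
        case True
        have "max 1 C \<le> k powr s y" unfolding ks0[symmetric] using k s0(2)[OF y] by (rule powr_mono[rotated])
        then have "l powr s y / k powr s y \<le> l powr s y / max 1 C"
          using k by (intro divide_left_mono mult_pos_pos) auto
        then have "(l / k) powr s y \<le> 1 / max 1 C * l powr s y"
          using k l by (simp add: powr_divide)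
        then have "ennreal ((l / k) powr s y) \<le> ennreal (1 / max 1 C) * ennreal (l powr s y)"
          by (subst ennreal_mult'[symmetric]) (auto intro: ennreal_leI)
        then show ?thesis using True k l by simp
      qed simp
    qed
    also have "\<dots> = ennreal (1 / max 1 C) * (\<integral>\<^sup>+y. ennreal (l powr s y) * indicator E y \<partial>lebesgue_on \<Omega>)"
      by (rule nn_integral_cmult) measurable
    also have "\<dots> \<le> ennreal (1 / max 1 C) * ennreal (max 1 C)"
      using bound[OF l] unfolding E_def by (intro mult_left_mono) (auto intro: order_trans ennreal_leI)
    also have "\<dots> = 1" by (subst ennreal_mult'[symmetric]) auto
    finally have "modular \<Omega> s (\<lambda>x. indicator E x / (k / l)) \<le> 1" .
    then have "Luxemburg_norm \<Omega> s (indicator E) \<le> ennreal (k / l)"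
      unfolding Luxemburg_norm_def using k l by (intro Inf_lower) auto
    then have "ennreal l * Luxemburg_norm \<Omega> s (indicator E) \<le> ennreal l * ennreal (k / l)"
      by (rule mult_left_mono) simp
    also have "\<dots> = ennreal k" using k l by (subst ennreal_mult'[symmetric]) auto
    finally show ?thesis by (simp add: E_def)
  qed
  then have "(SUP l\<in>{0<..}. ennreal l * Luxemburg_norm \<Omega> s (indicator {x \<in> \<Omega>. ereal l < \<bar>F x\<bar>})) \<le> ennreal k"
    by (intro SUP_least) auto
  also have "\<dots> < \<infinity>" by simp
  finally show ?thesis unfolding weak_var_Lspace_def using F by simp
qed

section \<open>The Sobolev conjugate and the weak type estimate\<close>

lemma Sobolev_conjugate_bounds:
  fixes p \<alpha> :: "real ^ 'n \<Rightarrow> real"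
  assumes "1 \<le> p x" "p x \<le> P" "0 \<le> \<alpha> x" "\<alpha> x * p x \<le> b" "b < real CARD('n)"
  shows "p x \<le> Sobolev_conjugate \<alpha> p x"
    and "Sobolev_conjugate \<alpha> p x \<le> real CARD('n) * P / (real CARD('n) - b)"
    and "1 / p x - \<alpha> x / real CARD('n) = 1 / Sobolev_conjugate \<alpha> p x"
proof -
  let ?N = "real CARD('n)"
  have d: "0 < ?N - \<alpha> x * p x" "?N - b \<le> ?N - \<alpha> x * p x" "?N - \<alpha> x * p x \<le> ?N" using assms by auto
  have "p x * (?N - \<alpha> x * p x) \<le> p x * ?N" using d(3) assms by (intro mult_left_mono) auto
  then show "p x \<le> Sobolev_conjugate \<alpha> p x"
    unfolding Sobolev_conjugate_def using d by (simp add: field_simps)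
  show "Sobolev_conjugate \<alpha> p x \<le> ?N * P / (?N - b)"
    unfolding Sobolev_conjugate_def using assms d by (intro frac_le mult_left_mono mult_nonneg_nonneg) auto
  show "1 / p x - \<alpha> x / ?N = 1 / Sobolev_conjugate \<alpha> p x"
    unfolding Sobolev_conjugate_def using assms d by (simp add: field_simps)
qed

lemma loc_log_Holder_on_Sobolev_conjugate_quotient:
  fixes \<Omega> :: "(real ^ 'n) set" and p \<alpha> q :: "real ^ 'n \<Rightarrow> real"
  assumes p: "loc_log_Holder_on \<Omega> p" "\<And>x. x \<in> \<Omega> \<Longrightarrow> \<bar>p x\<bar> \<le> P"
    and \<alpha>: "loc_log_Holder_on \<Omega> \<alpha>" "\<And>x. x \<in> \<Omega> \<Longrightarrow> \<bar>\<alpha> x\<bar> \<le> B"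
    and \<alpha>p: "\<And>x. x \<in> \<Omega> \<Longrightarrow> \<alpha> x * p x \<le> b" "b < real CARD('n)"
    and q: "loc_log_Holder_on \<Omega> q" "0 < q0" "\<And>x. x \<in> \<Omega> \<Longrightarrow> q0 \<le> q x"
  shows "loc_log_Holder_on \<Omega> (\<lambda>x. Sobolev_conjugate \<alpha> p x / q x)"
proof -
  let ?N = "real CARD('n)"
  let ?D = "\<lambda>x. ?N - \<alpha> x * p x"
  have D: "?N - b \<le> ?D x" if "x \<in> \<Omega>" for x using \<alpha>p(1)[OF that] by simp
  have rD: "loc_log_Holder_on \<Omega> (\<lambda>x. 1 / ?D x)"
    using D \<alpha>p(2) by (intro loc_log_Holder_on_inverse[of _ _ "?N - b"] loc_log_Holder_on_const_diff
        loc_log_Holder_on_mult[OF \<alpha> p]) auto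
  have rD_bd: "\<bar>1 / ?D x\<bar> \<le> 1 / (?N - b)" if "x \<in> \<Omega>" for x
    using D[OF that] \<alpha>p(2) by (simp add: frac_le)
  have rq: "loc_log_Holder_on \<Omega> (\<lambda>x. 1 / q x)" using q by (rule loc_log_Holder_on_inverse)
  have rq_bd: "\<bar>1 / q x\<bar> \<le> 1 / q0" if "x \<in> \<Omega>" for x
    using q(3)[OF that] q(2) by (simp add: frac_le)
  have "loc_log_Holder_on \<Omega> (\<lambda>x. ?N * (p x * (1 / ?D x * (1 / q x))))"
  proof (intro loc_log_Holder_on_cmult loc_log_Holder_on_mult[OF p] loc_log_Holder_on_mult[OF rD _ rq])
    fix x assume x: "x \<in> \<Omega>"
    then show "\<bar>1 / ?D x * (1 / q x)\<bar> \<le> 1 / (?N - b) * (1 / q0)"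
      unfolding abs_mult using rD_bd rq_bd \<alpha>p(2) by (intro mult_mono) auto
  qed (use rD_bd rq_bd in auto)
  then show ?thesis by (simp add: Sobolev_conjugate_def)
qed

text \<open>
  Hedberg's bound read backwards. With \<open>A = C powr - T * l powr (S x / q x)\<close> the bound
  \<open>C * A powr (1 / S x)\<close> is at most \<open>l powr (1 / q x)\<close>, since \<open>C \<ge> 1\<close> and \<open>T \<ge> S x\<close>. So a potential whose power \<open>q x\<close>
  exceeds \<open>l\<close> violates the growth condition on the mass of \<open>\<bar>f\<bar> powr p\<close> for some ball around \<open>x\<close>.
\<close>

lemma Riesz_superlevel_large_mass_ball:
  fixes \<Omega> :: "(real ^ 'n) set" and p \<alpha> q f :: "real ^ 'n \<Rightarrow> real"
  defines "N \<equiv> real CARD('n)" and "S \<equiv> Sobolev_conjugate \<alpha> p"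
  assumes C: "1 \<le> C"
    and Hedberg: "\<And>A. 1 \<le> A \<Longrightarrow>
      (\<And>t. 0 < t \<Longrightarrow> (\<integral>\<^sup>+y. ennreal (\<bar>f y\<bar> powr p y) * indicator (cball x t) y \<partial>lebesgue_on \<Omega>) \<le> ennreal (A * t powr N)) \<Longrightarrow>
      (\<integral>\<^sup>+y. ennreal (\<bar>f y\<bar> / norm (x - y) powr (N - \<alpha> y)) \<partial>lebesgue_on \<Omega>) \<le> ennreal (C * A powr (1 / S x))"
    and S: "0 < S x" "S x \<le> T" and q: "0 < q x"
    and l: "0 < l" "1 \<le> C powr - T * l powr (S x / q x)"
    and super: "ereal l < \<bar>ereal_powr (Riesz_potential \<Omega> \<alpha> f x) (q x)\<bar>"
  shows "\<exists>t>0. ennreal (C powr - T * l powr (S x / q x) * t powr N)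
           \<le> (\<integral>\<^sup>+y. ennreal (\<bar>f y\<bar> powr p y) * indicator (cball x t) y \<partial>lebesgue_on \<Omega>)"
proof (rule ccontr)
  assume no_ball: "\<not> ?thesis"
  define A where "A = C powr - T * l powr (S x / q x)"
  define I where "I = (\<integral>\<^sup>+y. ennreal (\<bar>f y\<bar> / norm (x - y) powr (N - \<alpha> y)) \<partial>lebesgue_on \<Omega>)"
  have "I \<le> ennreal (C * A powr (1 / S x))"
    unfolding I_def
  proof (rule Hedberg)
    show "1 \<le> A" using l by (simp add: A_def)
    show "(\<integral>\<^sup>+y. ennreal (\<bar>f y\<bar> powr p y) * indicator (cball x t) y \<partial>lebesgue_on \<Omega>) \<le> ennreal (A * t powr N)"
      if "0 < t" for t
      using no_ball that unfolding A_def by (meson linear)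
  qed
  also have "C * A powr (1 / S x) \<le> l powr (1 / q x)"
  proof -
    have "C * C powr (- T / S x) = C powr (1 + - T / S x)"
      using C by (subst powr_add) simp
    also have "\<dots> \<le> C powr 0" using C S by (intro powr_mono) (auto simp: field_simps)
    finally have "C * C powr (- T / S x) \<le> 1" using C by simp
    then have "C * C powr (- T / S x) * l powr (1 / q x) \<le> 1 * l powr (1 / q x)"
      by (rule mult_right_mono) simp
    moreover have "A powr (1 / S x) = C powr (- T / S x) * l powr (1 / q x)"
      using S C l by (simp add: A_def powr_mult powr_powr)
    ultimately show ?thesis by (simp add: mult.assoc)
  qed
  finally have I: "I \<le> ennreal (l powr (1 / q x))" by (simp add: ennreal_leI)
  then obtain r where r: "0 \<le> r" "I = ennreal r"
    by (metis ennreal_cases ennreal_neq_top neq_top_trans)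
  have "r \<le> l powr (1 / q x)" using I r by simp
  then have "r powr q x \<le> (l powr (1 / q x)) powr q x" using r q by (intro powr_mono2) auto
  also have "\<dots> = l" using q l by (simp add: powr_powr)
  finally have "r powr q x \<le> l" .
  moreover have "Riesz_potential \<Omega> \<alpha> f x = ereal r"
    using r unfolding Riesz_potential_def I_def N_def by simp
  ultimately show False using super by (simp add: ereal_powr_def)
qed

theorem theorem4p3:
  fixes \<Omega> :: "(real ^ 'n) set"
    and p \<alpha> q f :: "real ^ 'n \<Rightarrow> real"
  assumes "open \<Omega>" and "bounded \<Omega>"
    and "p \<in> P1_log \<Omega>" and "\<alpha> \<in> P0_log \<Omega>"
    and "ess_sup_on \<Omega> (\<lambda>x. \<alpha> x * p x) < ereal (real CARD('n))"
    and "f \<in> var_Lspace \<Omega> p"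
    and "q \<in> P0_log \<Omega>"
  shows "(\<lambda>x. ereal_powr (Riesz_potential \<Omega> \<alpha> f x) (q x))
           \<in> weak_var_Lspace \<Omega> (\<lambda>x. Sobolev_conjugate \<alpha> p x / q x)"
proof -
  let ?N = "real CARD('n)"
  have hp: "log_Holder_on \<Omega> p" and h\<alpha>: "log_Holder_on \<Omega> \<alpha>" and hq: "log_Holder_on \<Omega> q"
    and ess_p: "1 \<le> ess_inf_on \<Omega> p" and ess_\<alpha>: "0 < ess_inf_on \<Omega> \<alpha>" and ess_q: "0 < ess_inf_on \<Omega> q"
    using assms by (auto simp: P1_log_def P0_log_def)
  note lp = log_Holder_on_imp_loc[OF hp] and l\<alpha> = log_Holder_on_imp_loc[OF h\<alpha>]
    and lq = log_Holder_on_imp_loc[OF hq]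
  note cp = loc_log_Holder_on_imp_continuous_on[OF lp] and c\<alpha> = loc_log_Holder_on_imp_continuous_on[OF l\<alpha>]
    and cq = loc_log_Holder_on_imp_continuous_on[OF lq]
  obtain P where P: "0 < P" "\<And>x. x \<in> \<Omega> \<Longrightarrow> \<bar>p x\<bar> \<le> P" using log_Holder_on_imp_bounded[OF hp] by blast
  obtain B where B: "0 < B" "\<And>x. x \<in> \<Omega> \<Longrightarrow> \<bar>\<alpha> x\<bar> \<le> B" using log_Holder_on_imp_bounded[OF h\<alpha>] by blast
  obtain Q where Q: "0 < Q" "\<And>x. x \<in> \<Omega> \<Longrightarrow> \<bar>q x\<bar> \<le> Q" using log_Holder_on_imp_bounded[OF hq] by blast
  have p1: "1 \<le> p x" if x: "x \<in> \<Omega>" for x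
  proof (rule dense_le)
    fix e :: real assume "e < 1"
    then have "ereal e < 1" by simp
    then have "ereal e < ess_inf_on \<Omega> p" using ess_p by (rule less_le_trans)
    then show "e \<le> p x" using assms(1) cp x by (intro ge_of_less_ess_inf_on)
  qed
  obtain a0 where a0: "0 < a0" "\<And>x. x \<in> \<Omega> \<Longrightarrow> a0 \<le> \<alpha> x"
  proof -
    obtain e where "0 < ereal e" "ereal e < ess_inf_on \<Omega> \<alpha>" using ereal_dense2[OF ess_\<alpha>] by blast
    then show ?thesis using that ge_of_less_ess_inf_on[OF assms(1) c\<alpha>] by auto
  qed
  obtain q0 where q0: "0 < q0" "\<And>x. x \<in> \<Omega> \<Longrightarrow> q0 \<le> q x"
  proof -
    obtain e where "0 < ereal e" "ereal e < ess_inf_on \<Omega> q" using ereal_dense2[OF ess_q] by blast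
    then show ?thesis using that ge_of_less_ess_inf_on[OF assms(1) cq] by auto
  qed
  obtain b where b: "b < ?N" "\<And>x. x \<in> \<Omega> \<Longrightarrow> \<alpha> x * p x \<le> b"
  proof -
    obtain e where "ess_sup_on \<Omega> (\<lambda>x. \<alpha> x * p x) < ereal e" "ereal e < ereal ?N"
      using ereal_dense2[OF assms(5)] by blast
    then show ?thesis
      using that le_of_ess_sup_on_less[OF assms(1) continuous_on_mult[OF c\<alpha> cp]] by auto
  qed
  have f: "f \<in> borel_measurable (lebesgue_on \<Omega>)" "modular \<Omega> p f < \<infinity>"
    using assms(6) by (auto simp: var_Lspace_def)
  define S where "S = Sobolev_conjugate \<alpha> p"
  define s where "s x = S x / q x" for x
  define T where "T = ?N * P / (?N - b)"
  have S: "p x \<le> S x" "S x \<le> T" "1 / p x - \<alpha> x / ?N = 1 / S x" if x: "x \<in> \<Omega>" for x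
    unfolding S_def T_def using Sobolev_conjugate_bounds[of p x P \<alpha> b] p1[OF x] P(2)[OF x] a0(1) a0(2)[OF x] b(1) b(2)[OF x]
    by auto
  have T: "0 < T" using P b by (simp add: T_def)
  have ls: "loc_log_Holder_on \<Omega> s"
    unfolding s_def[abs_def] S_def
    using loc_log_Holder_on_Sobolev_conjugate_quotient[OF lp P(2) l\<alpha> B(2) b(2,1) lq q0] .
  have s_lower: "1 / Q \<le> s x" and s_upper: "s x \<le> T / q0" if x: "x \<in> \<Omega>" for x
    unfolding s_def using S[OF x] p1[OF x] q0(1) q0(2)[OF x] Q(1) Q(2)[OF x] T by (auto intro!: frac_le)
  note meas = continuous_on_imp_borel_measurable_lebesgue_on[OF assms(1)]
  note s_meas[measurable] = meas[OF loc_log_Holder_on_imp_continuous_on[OF ls]]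
  define F where "F x = ereal_powr (Riesz_potential \<Omega> \<alpha> f x) (q x)" for x
  have F[measurable]: "F \<in> borel_measurable (lebesgue_on \<Omega>)"
    unfolding F_def[abs_def]
    by (intro ereal_powr_borel_measurable Riesz_potential_borel_measurable assms(1) f(1) meas c\<alpha> cq)
  obtain C where C: "1 \<le> C" "\<And>x A. x \<in> \<Omega> \<Longrightarrow> 1 \<le> A \<Longrightarrow>
      (\<And>t. 0 < t \<Longrightarrow> (\<integral>\<^sup>+y. ennreal (\<bar>f y\<bar> powr p y) * indicator (cball x t) y \<partial>lebesgue_on \<Omega>) \<le> ennreal (A * t powr ?N)) \<Longrightarrow>
      (\<integral>\<^sup>+y. ennreal (\<bar>f y\<bar> / norm (x - y) powr (?N - \<alpha> y)) \<partial>lebesgue_on \<Omega>) \<le> ennreal (C * A powr (1 / p x - \<alpha> x / ?N))"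
    using Hedberg_bound[OF assms(1,2) lp p1 _ l\<alpha> a0 b f, of P] P(2) by (force simp: abs_le_iff)
  define c where "c = C powr - T"
  have c: "0 < c" using C(1) by (simp add: c_def)
  define w where "w y = ennreal (\<bar>f y\<bar> powr p y)" for y
  have w: "w \<in> borel_measurable (lebesgue_on \<Omega>)"
    unfolding w_def[abs_def] using f(1) meas[OF cp] by measurable
  have wfin: "(\<integral>\<^sup>+y. w y \<partial>lebesgue_on \<Omega>) < \<infinity>" using f(2) by (simp add: w_def modular_def)
  have Q': "0 < 1 / Q" using Q by simp
  obtain C1 where C1: "\<forall>l\<ge>1. \<forall>E\<subseteq>\<Omega>.
      (\<forall>x\<in>E. \<exists>t>0. ennreal (c * l powr s x * t powr ?N) \<le> (\<integral>\<^sup>+y. w y * indicator (cball x t) y \<partial>lebesgue_on \<Omega>)) \<longrightarrow>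
      (\<integral>\<^sup>+y. ennreal (l powr s y) * indicator E y \<partial>lebesgue_on \<Omega>) \<le> ennreal C1"
    by (rule exE[OF variable_weak_type_estimate[OF assms(1) ls Q' s_lower c w wfin]], assumption) (rule that)
  \<comment> \<open>From this level on the hypothesis \<open>A \<ge> 1\<close> of the pointwise bound holds at every point of \<open>\<Omega>\<close>.\<close>
  define l0 where "l0 = C powr (T * Q)"
  have l0: "1 \<le> l0" unfolding l0_def using C(1) T Q by (intro ge_one_powr_ge_zero) auto
  have fin: "emeasure lebesgue \<Omega> < \<infinity>"
    using assms(1,2) emeasure_bounded_finite[of \<Omega>] by simp
  define C2 where "C2 = l0 powr (T / q0) * measure lebesgue \<Omega>"
  have "F \<in> weak_var_Lspace \<Omega> s"
  proof (rule weak_var_LspaceI[OF assms(1) F s_meas Q' s_lower])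
    fix l :: real assume l: "0 < l"
    define E where "E = {x \<in> \<Omega>. ereal l < \<bar>F x\<bar>}"
    have "(\<integral>\<^sup>+y. ennreal (l powr s y) * indicator E y \<partial>lebesgue_on \<Omega>) \<le> ennreal (max C1 C2)"
    proof (cases "l0 \<le> l")
      case True
      have "(\<integral>\<^sup>+y. ennreal (l powr s y) * indicator E y \<partial>lebesgue_on \<Omega>) \<le> ennreal C1"
      proof (rule C1[rule_format])
        fix x assume "x \<in> E"
        then have x: "x \<in> \<Omega>" and super: "ereal l < \<bar>F x\<bar>" by (auto simp: E_def)
        have "C powr T = l0 powr (1 / Q)" using Q by (simp add: l0_def powr_powr)
        also have "\<dots> \<le> l powr (1 / Q)" using True l0 Q by (intro powr_mono2) auto
        also have "\<dots> \<le> l powr s x" using True l0 s_lower[OF x] by (intro powr_mono) auto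
        finally have "1 \<le> C powr - T * l powr s x"
          using C(1) by (simp add: powr_minus field_simps)
        then show "\<exists>t>0. ennreal (c * l powr s x * t powr ?N) \<le> (\<integral>\<^sup>+y. w y * indicator (cball x t) y \<partial>lebesgue_on \<Omega>)"
          unfolding c_def w_def s_def S_def
          using S[OF x] p1[OF x] q0(1) q0(2)[OF x] l super C(2)[OF x]
          by (intro Riesz_superlevel_large_mass_ball[OF C(1)]) (auto simp: S_def F_def)
      qed (use True l0 in \<open>auto simp: E_def\<close>)
      then show ?thesis by (rule order_trans) (simp add: ennreal_leI)
    next
      case False
      \<comment> \<open>Small levels are harmless because \<open>\<Omega>\<close> has finite measure and \<open>s\<close> is bounded.\<close>
      have "(\<integral>\<^sup>+y. ennreal (l powr s y) * indicator E y \<partial>lebesgue_on \<Omega>)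
          \<le> (\<integral>\<^sup>+y. ennreal (l0 powr (T / q0)) \<partial>lebesgue_on \<Omega>)"
      proof (rule nn_integral_mono)
        fix y assume "y \<in> space (lebesgue_on \<Omega>)"
        then have y: "y \<in> \<Omega>" by simp
        have "l powr s y \<le> l0 powr s y" using False l order_trans[OF less_imp_le[OF Q'] s_lower[OF y]] by (intro powr_mono2) auto
        also have "\<dots> \<le> l0 powr (T / q0)" using l0 s_upper[OF y] by (intro powr_mono) auto
        finally show "ennreal (l powr s y) * indicator E y \<le> ennreal (l0 powr (T / q0))"
          by (auto simp: indicator_def intro: ennreal_leI)
      qed
      also have "\<dots> = ennreal (l0 powr (T / q0)) * emeasure lebesgue \<Omega>"
        using assms(1) by (simp add: emeasure_restrict_space)
      also have "\<dots> = ennreal C2"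
        using fin by (simp add: C2_def ennreal_mult' emeasure_eq_ennreal_measure)
      finally show ?thesis by (rule order_trans) (simp add: ennreal_leI)
    qed
    then show "(\<integral>\<^sup>+y. ennreal (l powr s y) * indicator {x \<in> \<Omega>. ereal l < \<bar>F x\<bar>} y \<partial>lebesgue_on \<Omega>)
        \<le> ennreal (max C1 C2)" by (simp add: E_def)
  qed
  then show ?thesis by (simp add: F_def[abs_def] s_def[abs_def] S_def)
qed

end
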